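(* (1) For $m\ge0$, $$P_m(x-2)=2^{-m-1}\left(\left(1-\frac{\sqrt{x+2}}{\sqrt{x-2}}\right)\left(x-\sqrt{x^2-4}\right)^m+\left(1+\frac{\sqrt{x+2}}{\sqrt{x-2}}\right)\left(x+\sqrt{x^2-4}\right)^m\right)\quad(x\ne2),$$ $$Q_m(x-2)=2^{-m}\left(\left(x-\sqrt{x^2-4}\right)^m+\left(x+\sqrt{x^2-4}\right)^m\right).$$ (2) For integers $0\le r\le\lfloor m/2\rfloor$, $$P_m(x)=\sum_{j=0}^r(-1)^j\binom rj(x+2)^{r-j}P_{m-r-j}(x),\qquad Q_m(x)=\sum_{j=0}^r(-1)^j\binom rj(x+2)^{r-j}Q_{m-r-j}(x).$$ (3) For every polynomial $f$ of degree $<k$, $$\int_{-4}^0x^{1/2}(4+x)^{-1/2}P_k(x)f(x)\,dx=0,\qquad \int_{-4}^0x^{-1/2}(4+x)^{-1/2}Q_k(x)f(x)\,dx=0.$$ (4) The polynomial factors $p_n(s)$ of $M_n^P(s)$ and $q_n(s)$ of $M_n^Q(s)$ satisfy the functional equations $$p_n(s)=\pm p_n(1-s),\qquad q_n(s)=\pm q_n(1-s),$$ and have zeros only on the critical line $\mathrm{Re}\,s=1/2$.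
   Context: For an integer $m\ge0$: $P_m(x)=\sum_{k=0}^{m}\frac{2m+1}{2k+1}\binom{m+k}{2k}x^{k}$ and $Q_m(x)=2+\sum_{k=1}^{m}\frac{m}{k}\binom{m+k-1}{2k-1}x^k$. In (1) the square roots are chosen so that $\sqrt{x^2-4}=\sqrt{x-2}\,\sqrt{x+2}$. For $x<0$ powers are taken with the branch $x^w=|x|^we^{i\pi w}$, and $(-1)^w=e^{i\pi w}$. Mellin transforms: $M_m^P(s)=\int_{-4}^0\frac{P_m(x)x^{s-3/4}}{(4+x)^{3/4}}dx$ for $\mathrm{Re}\,s>-1/4$ and $M_m^Q(s)=\int_{-4}^0\frac{Q_m(x)x^{s-5/4}}{(4+x)^{3/4}}dx$ for $\mathrm{Re}\,s>1/4$. The polynomial factors $p_m,q_m$ are the polynomials (determined up to a non-zero constant factor, which is immaterial) such that, up to that factor, $$M_m^P(s)=(-1)^{s+5/4}4^s4^{-m-1}\Gamma(1/4)\,p_m(s)\frac{\Gamma(s+\frac14)}{\Gamma(s+\frac{2m+1}2)},\qquad M_m^Q(s)=(-1)^{s+3/4}4^{s-1}\Gamma(5/4)\,q_m(s)\frac{\Gamma(s-\frac14)}{\Gamma(s+m)}.$$ *)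

theory Defs
  imports "HOL-Analysis.Analysis" "HOL-Computational_Algebra.Polynomial"
begin

definition P :: "nat \<Rightarrow> complex \<Rightarrow> complex" where
  "P m x = (\<Sum>k=0..m. of_nat (2*m+1) / of_nat (2*k+1) * of_nat ((m+k) choose (2*k)) * x ^ k)"

definition Q :: "nat \<Rightarrow> complex \<Rightarrow> complex" where
  "Q m x = 2 + (\<Sum>k=1..m. of_nat m / of_nat k * of_nat ((m+k-1) choose (2*k-1)) * x ^ k)"

text \<open>The required branch of powers of negative reals is the one of the principal complex
  \<^const>\<open>powr\<close>, as the following two facts record.\<close>

lemma powr_negative_real:
  fixes x :: real and w :: complex
  assumes "x < 0"
  shows "complex_of_real x powr w = complex_of_real \<bar>x\<bar> powr w * exp (\<i> * of_real pi * w)"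
proof -
  have "Ln (complex_of_real x) = Ln (complex_of_real \<bar>x\<bar>) + \<i> * of_real pi"
    using assms Ln_of_real'[of x] Ln_of_real[of "-x"] by simp
  then show ?thesis
    using assms by (simp add: powr_def ring_distribs exp_add mult_ac)
qed

lemma powr_minus_one: "(-1 :: complex) powr w = exp (\<i> * of_real pi * w)"
  using powr_negative_real[of "-1" w] by simp

text \<open>The integrands are absolutely integrable for \<open>Re s > -1/4\<close> and \<open>Re s > 1/4\<close>,
  respectively; the values at the endpoints are irrelevant.\<close>

definition mellin_P :: "nat \<Rightarrow> complex \<Rightarrow> complex" where
  "mellin_P m s = integral {-4..0 :: real} (\<lambda>x.
     P m (of_real x) * of_real x powr (s - 3/4) / of_real (4 + x) powr (3/4))"

definition mellin_Q :: "nat \<Rightarrow> complex \<Rightarrow> complex" where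
  "mellin_Q m s = integral {-4..0 :: real} (\<lambda>x.
     Q m (of_real x) * of_real x powr (s - 5/4) / of_real (4 + x) powr (3/4))"

text \<open>The polynomial factors are determined only up to a non-zero constant \<open>c\<close>, so being a
  polynomial factor is a predicate.\<close>

definition is_factor_P :: "nat \<Rightarrow> complex poly \<Rightarrow> bool" where
  "is_factor_P m p \<longleftrightarrow> (\<exists>c. c \<noteq> 0 \<and> (\<forall>s. Re s > -1/4 \<longrightarrow>
     mellin_P m s = c * ((-1) powr (s + 5/4) * 4 powr s * 4 powr (- of_nat m - 1) * Gamma (1/4)
       * poly p s * (Gamma (s + 1/4) / Gamma (s + of_nat (2*m+1) / 2)))))"

definition is_factor_Q :: "nat \<Rightarrow> complex poly \<Rightarrow> bool" where
  "is_factor_Q m q \<longleftrightarrow> (\<exists>c. c \<noteq> 0 \<and> (\<forall>s. Re s > 1/4 \<longrightarrow>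
     mellin_Q m s = c * ((-1) powr (s + 3/4) * 4 powr (s - 1) * Gamma (5/4)
       * poly q s * (Gamma (s - 1/4) / Gamma (s + of_nat m)))))"

end

theory Submission
  imports Defs
begin

text \<open>Both families satisfy the three-term recurrence \<open>R\<^sub>m\<^sub>+\<^sub>2 = (x + 2) R\<^sub>m\<^sub>+\<^sub>1 - R\<^sub>m\<close> and are told apart by a parameter
\<open>e\<close> in the initial values (\<open>P_eq_cheb\<close>, \<open>Q_eq_cheb\<close>). The closed forms with radicals solve the
recurrence in terms of its characteristic roots, and the identity with binomial coefficients is an \<open>r\<close>-fold
application of it.

Orthogonality and the Mellin transforms rest on one integration by parts. The derivative of \<open>(-x)\<^sup>\<alpha> (4 + x)\<^sup>\<beta> R\<^sub>m(x)\<close> has integral 0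
over \<open>-4 \<le> x \<le> 0\<close>, and \<open>x (4 + x) R\<^sub>m'\<close> is a combination of \<open>R\<^sub>m\<^sub>+\<^sub>1\<close>, \<open>R\<^sub>m\<close>, \<open>R\<^sub>m\<^sub>-\<^sub>1\<close> (\<open>cheb_derivative\<close>).
This yields a three-term recurrence in \<open>m\<close> for the moments of \<open>R\<^sub>m\<close> against any Beta weight
(\<open>cheb_weighted_int_recurrence\<close>). For the two orthogonality weights it forces all moments with \<open>m \<ge> 1\<close> to vanish, and
multiplication by \<open>x\<close> then gives orthogonality.

For the Mellin weights, dividing by the moment of the constant function 1 and clearing a Pochhammer symbol
leaves, up to sign, polynomials \<open>k\<^sub>m\<close> in \<open>s\<close> with
\<open>k\<^sub>m\<^sub>+\<^sub>2 = 2 u k\<^sub>m\<^sub>+\<^sub>1 - (u\<^sup>2 - c\<^sub>m\<^sup>2) k\<^sub>m\<close> where \<open>u = s - 1/2\<close> and \<open>c\<^sub>m\<close> is real. The recurrence shows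
\<open>k\<^sub>m(1 - s) = (-1)\<^sup>m k\<^sub>m(s)\<close>. For \<open>Re u > 0\<close> the ratio \<open>k\<^sub>m\<^sub>+\<^sub>1 / k\<^sub>m - u\<close> stays in the closed right half-plane, because
the Moebius map that advances it preserves that half-plane; hence \<open>k\<^sub>m\<close> has no zero with \<open>Re s > 1/2\<close>, and
by the functional equation none with \<open>Re s < 1/2\<close> (\<open>crit_zero_imp_critical_line\<close>).

The moment of 1 is a Beta integral with a complex parameter, evaluated up to a constant factor in
\<open>weighted_int_1_eq_Gamma\<close>. As the Gamma and power factors do not vanish on the half-plane of convergence, the
polynomial factors are unique up to scaling, so every one of them is a multiple of \<open>k\<^sub>m\<close>.\<close>

section \<open>The two polynomial families as one recurrence\<close>

text \<open>The parameter \<open>e\<close> lets both families share every later computation: \<open>e = 1\<close> gives \<open>P\<close> and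
\<open>e = 0\<close> gives \<open>Q\<close>. With \<open>x = 2 cos \<theta> - 2\<close> these are \<open>sin ((m + 1/2) \<theta>) / sin (\<theta>/2)\<close> and
\<open>2 cos (m \<theta>)\<close>.\<close>

fun cheb :: "complex \<Rightarrow> nat \<Rightarrow> complex poly" where
  "cheb e 0 = [:2 - e:]"
| "cheb e (Suc 0) = [:2 + e, 1:]"
| "cheb e (Suc (Suc m)) = [:2, 1:] * cheb e (Suc m) - cheb e m"

lemma binomial_second_difference:
  "((n + 2) choose (k + 2)) + (n choose (k + 2)) = (n choose k) + 2 * ((n + 1) choose (k + 2))"
  by (simp add: numeral_2_eq_2)

lemma coeff_linear_times:
  "coeff ([:2, 1:] * p) k = 2 * coeff p k + (case k of 0 \<Rightarrow> 0 | Suc j \<Rightarrow> coeff p j)" for p :: "complex poly"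
  by (simp add: coeff_pCons split: nat.split)

text \<open>Written as sums of two binomial coefficients, the coefficients of \<open>P\<close> and \<open>Q\<close> satisfy the recurrence
because each summand does: this is the second difference of Pascal's rule.\<close>

lemma coeff_cheb_P:
  "coeff (cheb 1 m) k = of_nat (((m + k + 1) choose (2*k + 1)) + ((m + k) choose (2*k + 1)))"
proof (induction "1::complex" m arbitrary: k rule: cheb.induct)
  case 1
  then show ?case
    by (cases k) (simp_all add: binomial_eq_0 coeff_pCons del: binomial_Suc_Suc)
next
  case 2
  show ?case
  proof (cases "k < 2")
    case True
    then have "k = 0 \<or> k = 1" by linarith
    then show ?thesis by (auto simp: eval_nat_numeral)
  next
    case False
    then show ?thesis by (simp add: binomial_eq_0 coeff_pCons split: nat.split)
  qed
next
  case (3 m)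
  have "((m + k + 3) choose (2*k + 1)) + ((m + k + 2) choose (2*k + 1))
      + (((m + k + 1) choose (2*k + 1)) + ((m + k) choose (2*k + 1)))
    = 2 * (((m + k + 2) choose (2*k + 1)) + ((m + k + 1) choose (2*k + 1)))
     + (case k of 0 \<Rightarrow> 0 | Suc j \<Rightarrow> ((m + j + 2) choose (2*j + 1)) + ((m + j + 1) choose (2*j + 1)))"
  proof (cases k)
    case (Suc j)
    then show ?thesis
      using binomial_second_difference[of "m + j + 2" "2*j+1"] binomial_second_difference[of "m + j + 1" "2*j+1"]
      by (simp add: eval_nat_numeral add.commute add.left_commute del: binomial_Suc_Suc)
  qed auto
  from arg_cong[OF this, of "of_nat :: nat \<Rightarrow> complex"]
  show ?case
    unfolding cheb.simps coeff_diff coeff_linear_times 3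
    by (cases k) (simp_all add: algebra_simps 3)
qed

lemma coeff_cheb_Q:
  "coeff (cheb 0 m) k = of_nat (((m + k) choose (2*k)) + ((m + k - 1) choose (2*k)))"
proof (induction "0::complex" m arbitrary: k rule: cheb.induct)
  case 1
  then show ?case
    by (cases k) (simp_all add: binomial_eq_0 coeff_pCons del: binomial_Suc_Suc)
next
  case 2
  show ?case
  proof (cases "k < 2")
    case True
    then have "k = 0 \<or> k = 1" by linarith
    then show ?thesis by (auto simp: eval_nat_numeral)
  next
    case False
    then show ?thesis by (simp add: binomial_eq_0 coeff_pCons split: nat.split)
  qed
next
  case (3 m)
  have "((m + k + 2) choose (2*k)) + ((m + k + 1) choose (2*k))
      + (((m + k) choose (2*k)) + ((m + k - 1) choose (2*k)))
    = 2 * (((m + k + 1) choose (2*k)) + ((m + k) choose (2*k)))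
     + (case k of 0 \<Rightarrow> 0 | Suc j \<Rightarrow> ((m + j + 1) choose (2*j)) + ((m + j) choose (2*j)))"
  proof (cases k)
    case (Suc j)
    then show ?thesis
      using binomial_second_difference[of "m + j + 1" "2*j"] binomial_second_difference[of "m + j" "2*j"]
      by (simp add: add.commute add.left_commute)
  qed auto
  from arg_cong[OF this, of "of_nat :: nat \<Rightarrow> complex"]
  show ?case
    unfolding cheb.simps coeff_diff coeff_linear_times 3
    by (cases k) (simp_all add: algebra_simps 3)
qed

lemma degree_cheb_le: "degree (cheb e m) \<le> m"
proof (induction e m rule: cheb.induct)
  case (3 e m)
  have "degree ([:2, 1:] * cheb e (Suc m)) \<le> Suc (Suc m)"
    using degree_mult_le[of "[:2, 1:]" "cheb e (Suc m)"] 3 by simp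
  then show ?case
    unfolding cheb.simps using 3 by (intro degree_diff_le) auto
qed auto

lemma poly_eq_sum_upto:
  fixes p :: "'a::comm_semiring_1 poly"
  assumes "degree p \<le> n" shows "poly p x = (\<Sum>k=0..n. coeff p k * x ^ k)"
  proof -
  have "poly p x = (\<Sum>k\<le>degree p. coeff p k * x ^ k)" by (rule poly_altdef)
  also have "\<dots> = (\<Sum>k=0..n. coeff p k * x ^ k)"
    using assms by (intro sum.mono_neutral_left) (auto simp: coeff_eq_0)
  finally show ?thesis .
qed

lemma P_eq_cheb: "P m x = poly (cheb 1 m) x"
proof -
  have "of_nat (2*m+1) / of_nat (2*k+1) * of_nat ((m+k) choose (2*k)) = coeff (cheb 1 m) k" if "k \<le> m" for k
  proof -
    have 1: "(2*k+1) * ((m+k+1) choose (2*k+1)) = (m+k+1) * ((m+k) choose (2*k))"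
      using binomial_absorption[of "2*k" "m+k+1"] by simp
    have 2: "(2*k+1) * ((m+k) choose (2*k+1)) = (m-k) * ((m+k) choose (2*k))"
      using binomial_absorb_comp[of "m+k" "2*k"] binomial_absorption[of "2*k" "m+k"] that
      by simp
    have "(2*k+1) * (((m+k+1) choose (2*k+1)) + ((m+k) choose (2*k+1))) = (2*m+1) * ((m+k) choose (2*k))"
      unfolding distrib_left 1 2 using that by (simp flip: add_mult_distrib)
    from arg_cong[OF this, of "of_nat :: nat \<Rightarrow> complex"]
    have "of_nat (2*k+1) * coeff (cheb 1 m) k = of_nat (2*m+1) * of_nat ((m+k) choose (2*k))"
      unfolding coeff_cheb_P of_nat_mult .
    moreover have "of_nat (2*k+1) \<noteq> (0::complex)" by (metis of_nat_eq_0_iff add_is_0 one_neq_zero)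
    ultimately show ?thesis by (metis nonzero_mult_div_cancel_left times_divide_eq_left)
  qed
  then show ?thesis
    unfolding P_def poly_eq_sum_upto[OF degree_cheb_le] by (intro sum.cong) auto
qed

lemma Q_eq_cheb: "Q m x = poly (cheb 0 m) x"
proof -
  have "of_nat m / of_nat k * of_nat ((m+k-1) choose (2*k-1)) = coeff (cheb 0 m) k" if k: "1 \<le> k" "k \<le> m" for k
  proof -
    have 1: "(2*k) * ((m+k) choose (2*k)) = (m+k) * ((m+k-1) choose (2*k-1))"
      using binomial_absorption[of "2*k-1" "m+k"] that by (simp add: Suc_diff_Suc)
    have 2: "(2*k) * ((m+k-1) choose (2*k)) = (m-k) * ((m+k-1) choose (2*k-1))"
      using binomial_absorb_comp[of "m+k-1" "2*k-1"] binomial_absorption[of "2*k-1" "m+k-1"] that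
      by (simp add: Suc_diff_Suc)
    have "(2*k) * (((m+k) choose (2*k)) + ((m+k-1) choose (2*k))) = (2*m) * ((m+k-1) choose (2*k-1))"
      unfolding distrib_left 1 2 using that by (simp flip: add_mult_distrib)
    then have "k * (((m+k) choose (2*k)) + ((m+k-1) choose (2*k))) = m * ((m+k-1) choose (2*k-1))"
      by simp
    from arg_cong[OF this, of "of_nat :: nat \<Rightarrow> complex"]
    have "of_nat k * coeff (cheb 0 m) k = of_nat m * of_nat ((m+k-1) choose (2*k-1))"
      unfolding coeff_cheb_Q of_nat_mult .
    moreover have "of_nat k \<noteq> (0::complex)" using that by auto
    ultimately show ?thesis by (metis nonzero_mult_div_cancel_left times_divide_eq_left)
  qed
  moreover have "coeff (cheb 0 m) 0 = 2" by (simp add: coeff_cheb_Q)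
  ultimately show ?thesis
    unfolding Q_def poly_eq_sum_upto[OF degree_cheb_le]
    by (subst sum.atLeast_Suc_atMost) (auto intro!: sum.cong)
qed

text \<open>The recurrence is linear with constant coefficients in \<open>m\<close>, and \<open>t\<close>, \<open>u\<close> are its characteristic roots.\<close>

lemma poly_cheb_eq_powers:
  assumes t: "t\<^sup>2 = x * t - 1" and u: "u\<^sup>2 = x * u - 1"
    and "A + B = 2 - e" and "A * u + B * t = x + e"
  shows "poly (cheb e m) (x - 2) = A * u ^ m + B * t ^ m"
proof (induction m rule: induct_nat_012)
  case (ge2 m)
  have *: "t ^ Suc (Suc m) = x * t ^ Suc m - t ^ m" "u ^ Suc (Suc m) = x * u ^ Suc m - u ^ m"
    using arg_cong[OF t, of "\<lambda>z. z * t ^ m"] arg_cong[OF u, of "\<lambda>z. z * u ^ m"]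
    by (simp_all add: power2_eq_square algebra_simps)
  show ?case
    unfolding * cheb.simps poly_diff poly_mult using ge2 by (simp add: algebra_simps)
qed (use assms in \<open>simp_all add: algebra_simps\<close>)

lemma cheb_radicals:
  fixes a b x :: complex
  assumes a: "a\<^sup>2 = x - 2" and b: "b\<^sup>2 = x + 2"
  shows "x \<noteq> 2 \<Longrightarrow>
      P m (x - 2) = 1 / 2 ^ (m + 1) * ((1 - b / a) * (x - a * b) ^ m + (1 + b / a) * (x + a * b) ^ m)"
    and "Q m (x - 2) = 1 / 2 ^ m * ((x - a * b) ^ m + (x + a * b) ^ m)"
proof -
  define w where "w = a * b"
  define t u where "t = (x + w) / 2" and "u = (x - w) / 2"
  have "w\<^sup>2 = x\<^sup>2 - 4"
    unfolding w_def power_mult_distrib a b by (simp add: power2_eq_square algebra_simps)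
  moreover have "t\<^sup>2 - (x * t - 1) = (w\<^sup>2 - (x\<^sup>2 - 4)) / 4" "u\<^sup>2 - (x * u - 1) = (w\<^sup>2 - (x\<^sup>2 - 4)) / 4"
    by (simp_all add: t_def u_def power2_eq_square field_simps)
  ultimately have t: "t\<^sup>2 = x * t - 1" and u: "u\<^sup>2 = x * u - 1"
    by simp_all
  have pow: "(x + a * b) ^ m = 2 ^ m * t ^ m" "(x - a * b) ^ m = 2 ^ m * u ^ m"
    by (simp_all add: t_def u_def w_def power_divide)
  show "Q m (x - 2) = 1 / 2 ^ m * ((x - a * b) ^ m + (x + a * b) ^ m)"
    unfolding pow Q_eq_cheb
    by (subst poly_cheb_eq_powers[OF t u, where A = 1 and B = 1])
       (simp_all add: t_def u_def field_simps)
  assume "x \<noteq> 2"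
  then have "a \<noteq> 0" using a by auto
  have "(1 - b / a) / 2 * u + (1 + b / a) / 2 * t = (x + b\<^sup>2) / 2"
    using \<open>a \<noteq> 0\<close> by (simp add: w_def t_def u_def field_simps power2_eq_square)
  also have "\<dots> = x + 1"
    unfolding b by (simp add: field_simps)
  finally have 1: "(1 - b / a) / 2 * u + (1 + b / a) / 2 * t = x + 1" .
  show "P m (x - 2) = 1 / 2 ^ (m + 1) * ((1 - b / a) * (x - a * b) ^ m + (1 + b / a) * (x + a * b) ^ m)"
    unfolding pow P_eq_cheb
    by (subst poly_cheb_eq_powers[OF t u _ 1]) (simp_all add: field_simps)
qed

text \<open>Induction on \<open>r\<close> replaces each \<open>R (m - r - j)\<close> by the recurrence and collects terms with Pascal's rule;
symbolically, \<open>1 = ((t + 1/t) - 1/t)\<^sup>r t\<^sup>-\<^sup>r\<close> on the solution \<open>t\<^sup>m\<close>.\<close>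

lemma cheb_binomial_identity:
  assumes "r \<le> m div 2"
  shows "poly (cheb e m) x =
    (\<Sum>j=0..r. (-1) ^ j * of_nat (r choose j) * (x + 2) ^ (r - j) * poly (cheb e (m - r - j)) x)"
  using assms
proof (induction r)
  case (Suc r)
  define R where "R = (\<lambda>m. poly (cheb e m) x)"
  let ?c = "\<lambda>j. (-1) ^ j * of_nat (r choose j) :: complex"
  have rec: "R (m - r - j) = (x + 2) * R (m - Suc r - j) - R (m - Suc r - Suc j)" if "j \<le> r" for j
  proof -
    have "m - r - j = Suc (Suc (m - Suc r - Suc j))" "m - Suc r - j = Suc (m - Suc r - Suc j)"
      using Suc.prems that by linarith+
    then show ?thesis by (simp add: R_def algebra_simps)
  qed
  have "R m = (\<Sum>j=0..r. ?c j * (x + 2) ^ (r - j) * R (m - r - j))"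
    unfolding R_def using Suc by simp
  also have "\<dots> = (\<Sum>j=0..r. ?c j * (x + 2) ^ (Suc r - j) * R (m - Suc r - j))
      - (\<Sum>j=0..r. ?c j * (x + 2) ^ (r - j) * R (m - Suc r - Suc j))"
    unfolding sum_subtractf[symmetric]
    by (intro sum.cong refl) (simp add: rec Suc_diff_le right_diff_distrib mult_ac del: diff_diff_left)
  also have "(\<Sum>j=0..r. ?c j * (x + 2) ^ (Suc r - j) * R (m - Suc r - j))
      = (\<Sum>j=0..Suc r. ?c j * (x + 2) ^ (Suc r - j) * R (m - Suc r - j))"
    by simp
  also have "\<dots> = (x + 2) ^ Suc r * R (m - Suc r)
      + (\<Sum>j=0..r. ?c (Suc j) * (x + 2) ^ (r - j) * R (m - Suc r - Suc j))"
    by (subst sum.atLeast0_atMost_Suc_shift) simp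
  also have "\<dots> - (\<Sum>j=0..r. ?c j * (x + 2) ^ (r - j) * R (m - Suc r - Suc j))
      = (x + 2) ^ Suc r * R (m - Suc r)
      + (\<Sum>j=0..r. (-1) ^ Suc j * of_nat (Suc r choose Suc j) * (x + 2) ^ (r - j) * R (m - Suc r - Suc j))"
    unfolding add_diff_eq[symmetric] sum_subtractf[symmetric]
    by (intro arg_cong2[of _ _ _ _ "(+)"] sum.cong refl) (simp add: algebra_simps)
  also have "\<dots> = (\<Sum>j=0..Suc r. (-1) ^ j * of_nat (Suc r choose j) * (x + 2) ^ (Suc r - j) * R (m - Suc r - j))"
    by (subst sum.atLeast0_atMost_Suc_shift) simp
  finally show ?case unfolding R_def .
qed simp

text \<open>In the variable \<open>t\<close> with \<open>x + 2 = t + 1/t\<close> one has \<open>x (4 + x) = (t - 1/t)\<^sup>2\<close> and \<open>dx/dt = (t - 1/t)/t\<close>,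
so the operator on the left sends \<open>t\<^sup>j\<close> to \<open>j (t\<^sup>j\<^sup>+\<^sup>1 - t\<^sup>j\<^sup>-\<^sup>1)\<close> and raises the index by at most
one. The condition on \<open>e\<close> is what the two initial cases need.\<close>

lemma cheb_derivative:
  assumes "e = 0 \<or> e = 1"
  shows "x * (4 + x) * poly (pderiv (cheb e (Suc m))) x =
     of_nat (Suc m) * poly (cheb e (Suc (Suc m))) x - e * poly (cheb e (Suc m)) x
     - (of_nat (Suc m) + e) * poly (cheb e m) x"
proof (induction m rule: induct_nat_012)
  case (ge2 m)
  define R D where "R = (\<lambda>k. poly (cheb e k) x)" and "D = (\<lambda>k. poly (pderiv (cheb e k)) x)"
  have R: "R (Suc (Suc k)) = (x + 2) * R (Suc k) - R k" for k
    by (simp add: R_def algebra_simps)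
  have D: "D (Suc (Suc (Suc m))) = R (Suc (Suc m)) + (x + 2) * D (Suc (Suc m)) - D (Suc m)"
    unfolding R_def D_def cheb.simps(3)[of e "Suc m"] pderiv_diff pderiv_mult
    by (simp add: pderiv_pCons algebra_simps)
  have IH: "x * (4 + x) * D (Suc m) = of_nat (Suc m) * R (Suc (Suc m)) - e * R (Suc m)
        - (of_nat (Suc m) + e) * R m"
    "x * (4 + x) * D (Suc (Suc m)) = of_nat (Suc (Suc m)) * R (Suc (Suc (Suc m))) - e * R (Suc (Suc m))
        - (of_nat (Suc (Suc m)) + e) * R (Suc m)"
    unfolding R_def D_def using ge2 by this+
  have "x * (4 + x) * D (Suc (Suc (Suc m))) =
      x * (4 + x) * R (Suc (Suc m)) + (x + 2) * (x * (4 + x) * D (Suc (Suc m))) - x * (4 + x) * D (Suc m)"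
    unfolding D by (simp add: algebra_simps)
  also have "\<dots> = of_nat (Suc (Suc (Suc m))) * R (Suc (Suc (Suc (Suc m)))) - e * R (Suc (Suc (Suc m)))
     - (of_nat (Suc (Suc (Suc m))) + e) * R (Suc (Suc m))"
    unfolding IH by (simp add: R algebra_simps)
  finally show ?case unfolding R_def D_def .
qed (use assms in \<open>auto simp: pderiv_pCons pderiv_diff pderiv_mult algebra_simps\<close>)

section \<open>Polynomials with all zeros on the critical line\<close>

text \<open>With \<open>u = s - 1/2\<close> this reads \<open>k\<^sub>m\<^sub>+\<^sub>2 = 2 u k\<^sub>m\<^sub>+\<^sub>1 - (u\<^sup>2 - c\<^sub>m\<^sup>2) k\<^sub>m\<close>, the recurrence which integration by parts
produces for the polynomial factors. The argument for the zeros works for every real sequence \<open>c\<close>.\<close>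

fun crit_poly :: "(nat \<Rightarrow> real) \<Rightarrow> nat \<Rightarrow> complex poly" where
  "crit_poly c 0 = 1"
| "crit_poly c (Suc 0) = [:-1/2, 1:]"
| "crit_poly c (Suc (Suc m)) =
     smult 2 ([:-1/2, 1:] * crit_poly c (Suc m)) - ([:-1/2, 1:]\<^sup>2 - [:of_real ((c m)\<^sup>2):]) * crit_poly c m"

lemma poly_crit_poly_rec:
  "poly (crit_poly c (Suc (Suc m))) s =
     2 * (s - 1/2) * poly (crit_poly c (Suc m)) s - ((s - 1/2)\<^sup>2 - of_real ((c m)\<^sup>2)) * poly (crit_poly c m) s"
  by (simp add: algebra_simps)

lemma crit_reflect: "poly (crit_poly c m) (1 - s) = (-1) ^ m * poly (crit_poly c m) s"
proof (induction c m rule: crit_poly.induct)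
  case (3 c m)
  then show ?case
    unfolding poly_crit_poly_rec by (simp add: algebra_simps power2_eq_square)
qed simp_all

lemma Re_inverse_nonneg: "Re z \<ge> 0 \<Longrightarrow> Re (inverse z) \<ge> 0"
  by (simp add: Re_inverse)

text \<open>For \<open>Re u > 0\<close> the quantity \<open>r = k\<^sub>m\<^sub>+\<^sub>1 / k\<^sub>m - u\<close> evolves by the Moebius map
\<open>r \<mapsto> (u r + c\<^sup>2) / (u + r) = 1 / (1/u + 1/r) + c\<^sup>2 / (u + r)\<close>. Inversion preserves the closed right
half-plane, hence so does this map, and \<open>k\<^sub>m\<^sub>+\<^sub>1 = (u + r) k\<^sub>m\<close> cannot vanish.\<close>

lemma crit_nonzero_right:
  assumes s: "Re s > 1/2"
  shows "poly (crit_poly c m) s \<noteq> 0 \<and> Re (poly (crit_poly c (Suc m)) s / poly (crit_poly c m) s - (s - 1/2)) \<ge> 0"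
proof (induction m)
  case 0
  then show ?case by simp
next
  case (Suc m)
  define u where "u = s - 1/2"
  define r where "r = poly (crit_poly c (Suc m)) s / poly (crit_poly c m) s - u"
  have u: "Re u > 0" and r: "Re r \<ge> 0" and nz: "poly (crit_poly c m) s \<noteq> 0"
    using s Suc by (auto simp: u_def r_def)
  have "Re (u + r) > 0" using u r by simp
  then have ur: "u + r \<noteq> 0" and "u \<noteq> 0"
    using u by (metis less_irrefl zero_complex.simps(1))+
  have k1: "poly (crit_poly c (Suc m)) s = (u + r) * poly (crit_poly c m) s"
    using nz by (simp add: r_def)
  have "poly (crit_poly c (Suc (Suc m))) s / poly (crit_poly c (Suc m)) s - u
      = (u * r + of_real ((c m)\<^sup>2)) / (u + r)"
  proof -
    have "2 * u * ((u + r) * k) - (u\<^sup>2 - C) * k = ((u * r + C) + u * (u + r)) * k" for k C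
      by (simp add: algebra_simps power2_eq_square)
    then show ?thesis
      unfolding poly_crit_poly_rec k1 u_def[symmetric] using nz ur by (simp add: add_divide_distrib)
  qed
  also have "\<dots> = u * r / (u + r) + of_real ((c m)\<^sup>2) * inverse (u + r)"
    by (simp add: divide_inverse algebra_simps)
  finally have "poly (crit_poly c (Suc (Suc m))) s / poly (crit_poly c (Suc m)) s - u
      = u * r / (u + r) + of_real ((c m)\<^sup>2) * inverse (u + r)" .
  moreover have "Re (u * r / (u + r)) \<ge> 0"
  proof (cases "r = 0")
    case False
    then have "u * r / (u + r) = inverse (inverse u + inverse r)"
      using \<open>u \<noteq> 0\<close> ur by (simp add: field_simps)
    then show ?thesis
      using Re_inverse_nonneg[of "inverse u + inverse r"] Re_inverse_nonneg[of u] Re_inverse_nonneg[of r] u r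
      by simp
  qed simp
  moreover have "Re (of_real ((c m)\<^sup>2) * inverse (u + r)) \<ge> 0"
    using Re_inverse_nonneg[of "u + r"] u r by (simp flip: of_real_power)
  ultimately have "Re (poly (crit_poly c (Suc (Suc m))) s / poly (crit_poly c (Suc m)) s - u) \<ge> 0"
    by simp
  then show ?case using k1 nz ur unfolding u_def by simp
qed

lemma crit_zero_imp_critical_line:
  assumes "poly (crit_poly c m) s = 0"
  shows "Re s = 1/2"
  using crit_nonzero_right[of s c m] crit_nonzero_right[of "1 - s" c m] assms crit_reflect[of c m s]
  by force

section \<open>Beta weights on the interval from -4 to 0\<close>

text \<open>The base \<open>-x\<close> is nonnegative on the interval, so no branch is involved; the phase \<open>exp (\<i> \<pi> (\<alpha> - 1))\<close> that
turns this into a power of \<open>x\<close> is constant and is restored at the end.\<close>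

definition weight :: "complex \<Rightarrow> complex \<Rightarrow> real \<Rightarrow> complex" where
  "weight \<alpha> \<beta> x = of_real (- x) powr (\<alpha> - 1) * of_real (4 + x) powr (\<beta> - 1)"

lemma norm_weight: "x \<in> {-4..0} \<Longrightarrow> norm (weight \<alpha> \<beta> x) = (- x) powr (Re \<alpha> - 1) * (4 + x) powr (Re \<beta> - 1)"
  using norm_powr_real_powr[of "complex_of_real (- x)" "\<alpha> - 1"] norm_powr_real_powr[of "complex_of_real (4 + x)" "\<beta> - 1"]
  by (simp add: weight_def norm_mult)

lemma real_weight_integrable:
  fixes a b :: real
  assumes "a > 0" "b > 0"
  shows "(\<lambda>x. (- x) powr (a - 1) * (4 + x) powr (b - 1)) integrable_on {-4..0}"
proof -
  have "((\<lambda>t. t powr (a - 1) * (1 - t) powr (b - 1)) has_integral Beta a b) (cbox 0 1)"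
    using has_integral_Beta_real[OF assms] by simp
  from has_integral_affinity[OF this, of "-1/4" 0]
  have "((\<lambda>x. (- x / 4) powr (a - 1) * (1 + x / 4) powr (b - 1)) has_integral 4 * Beta a b)
      ((\<lambda>x. - (4 * x)) ` {0..1})"
    by simp
  also have "(\<lambda>x::real. - (4 * x)) ` {0..1} = {-4..0}"
    using image_mult_atLeastAtMost_if[of "-4" "0::real" 1] by simp
  finally have "(\<lambda>x. (- x / 4) powr (a - 1) * (1 + x / 4) powr (b - 1)) integrable_on {-4..0}"
    by (rule has_integral_integrable)
  then have "(\<lambda>x. (4 powr (a - 1) * 4 powr (b - 1)) * ((- x / 4) powr (a - 1) * (1 + x / 4) powr (b - 1)))
      integrable_on {-4..0}"
    by (rule integrable_on_mult_right)
  moreover have "(4 powr (a - 1) * 4 powr (b - 1)) * ((- x / 4) powr (a - 1) * (1 + x / 4) powr (b - 1))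
      = (- x) powr (a - 1) * (4 + x) powr (b - 1)" if "x \<in> {-4..0}" for x :: real
  proof -
    have "4 powr (a - 1) * (- x / 4) powr (a - 1) = (- x) powr (a - 1)"
         "4 powr (b - 1) * (1 + x / 4) powr (b - 1) = (4 + x) powr (b - 1)"
      using that by (simp_all flip: powr_mult)
    then show ?thesis by (metis mult.assoc mult.left_commute)
  qed
  ultimately show ?thesis by (rule integrable_eq)
qed

lemma weight_continuous_on_open: "continuous_on {-4<..<0} (weight \<alpha> \<beta>)"
proof -
  have "4 + complex_of_real x \<noteq> 0" if "x > -4" for x
    using that by (auto simp: complex_eq_iff)
  then show ?thesis unfolding weight_def by (intro continuous_intros) auto
qed

text \<open>The modulus of the weight is a weight with real exponents, integrable as a Beta integral.\<close>

lemma weight_mult_integrable: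
  assumes "Re \<alpha> > 0" "Re \<beta> > 0" and f: "continuous_on {-4..0} f"
  shows "(\<lambda>x. weight \<alpha> \<beta> x * f x) integrable_on {-4..0}"
proof -
  have "bounded (f ` {-4..0})" using f by (intro compact_imp_bounded compact_continuous_image) auto
  then obtain B where B: "\<And>x. x \<in> {-4..0} \<Longrightarrow> norm (f x) \<le> B"
    unfolding bounded_iff by blast
  have "(\<lambda>x. weight \<alpha> \<beta> x * f x) absolutely_integrable_on {-4<..<0}"
  proof (rule measurable_bounded_by_integrable_imp_absolutely_integrable)
    have "continuous_on {-4<..<0} (\<lambda>x. weight \<alpha> \<beta> x * f x)"
      by (intro continuous_intros weight_continuous_on_open continuous_on_subset[OF f]) auto
    then show "(\<lambda>x. weight \<alpha> \<beta> x * f x) \<in> borel_measurable (lebesgue_on {-4<..<0})"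
      by (rule continuous_imp_measurable_on_sets_lebesgue) auto
    show "(\<lambda>x. ((- x) powr (Re \<alpha> - 1) * (4 + x) powr (Re \<beta> - 1)) * B) integrable_on {-4<..<0}"
      using real_weight_integrable[OF assms(1,2)]
      by (intro integrable_on_mult_left) (simp add: integrable_on_Icc_iff_Ioo)
    show "norm (weight \<alpha> \<beta> x * f x) \<le> ((- x) powr (Re \<alpha> - 1) * (4 + x) powr (Re \<beta> - 1)) * B"
      if "x \<in> {-4<..<0}" for x
      using that B[of x] by (auto simp: norm_mult norm_weight intro!: mult_left_mono)
  qed auto
  then show ?thesis
    by (simp add: integrable_on_Icc_iff_Ioo set_lebesgue_integral_eq_integral(1))
qed

definition weighted_int :: "complex \<Rightarrow> complex \<Rightarrow> (complex \<Rightarrow> complex) \<Rightarrow> complex" where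
  "weighted_int \<alpha> \<beta> f = integral {-4..0} (\<lambda>x. weight \<alpha> \<beta> x * f (of_real x))"

lemma weighted_int_has_integral:
  assumes "Re \<alpha> > 0" "Re \<beta> > 0" "continuous_on UNIV f"
  shows "((\<lambda>x. weight \<alpha> \<beta> x * f (of_real x)) has_integral weighted_int \<alpha> \<beta> f) {-4..0}"
  unfolding weighted_int_def using assms
  by (intro integrable_integral weight_mult_integrable continuous_on_compose2[OF assms(3)] continuous_intros) auto

lemma powr_eq_pred_times: "z \<noteq> 0 \<Longrightarrow> z powr w = z powr (w - 1) * z" for z w :: complex
  using powr_add[of z "w - 1" 1] by simp

lemma weight_times_x: "x \<in> {-4..0} \<Longrightarrow> weight \<alpha> \<beta> x * of_real x = - weight (\<alpha> + 1) \<beta> x"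
  using powr_add[of "complex_of_real (-x)" "\<alpha> - 1" 1]
  by (cases "x = 0") (auto simp: weight_def algebra_simps)

text \<open>The integrand is, up to sign, the derivative of \<open>(-x)\<^sup>\<alpha> (4 + x)\<^sup>\<beta> f(x)\<close>, which vanishes at both endpoints.\<close>

lemma Pearson_integral:
  assumes "Re \<alpha> > 0" "Re \<beta> > 0"
  shows "weighted_int \<alpha> \<beta> (\<lambda>x. x * (4 + x) * poly (pderiv f) x + (\<alpha> * (4 + x) + \<beta> * x) * poly f x) = 0"
proof -
  define F where "F = (\<lambda>x::real. of_real (- x) powr \<alpha> * of_real (4 + x) powr \<beta> * poly f (of_real x))"
  define g where "g = (\<lambda>x. x * (4 + x) * poly (pderiv f) x + (\<alpha> * (4 + x) + \<beta> * x) * poly f x)"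
  \<comment> \<open>The minus sign comes from differentiating powers of \<open>-x\<close>.\<close>
  have "((\<lambda>x. - (weight \<alpha> \<beta> x * g (of_real x))) has_integral F 0 - F (-4)) {-4..0}"
  proof (rule fundamental_theorem_of_calculus_interior)
    show "continuous_on {-4..0} F"
      unfolding F_def using assms
      by (intro continuous_on_mult continuous_on_powr_complex continuous_intros) auto
    fix x :: real assume x: "x \<in> {-4<..<0}"
    have 1: "of_real (- x) powr \<alpha> = of_real (- x) powr (\<alpha> - 1) * of_real (- x)"
      using x by (intro powr_eq_pred_times) simp
    have 2: "of_real (4 + x) powr \<beta> = of_real (4 + x) powr (\<beta> - 1) * of_real (4 + x)"
      using x by (intro powr_eq_pred_times) (simp only: of_real_eq_0_iff, simp)
    have "((\<lambda>z. (- z) powr \<alpha>) has_field_derivative \<alpha> * (- of_real x) powr (\<alpha> - 1) * (-1)) (at (of_real x))"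
      by (rule DERIV_chain2[where g = uminus, OF has_field_derivative_powr])
         (use x in \<open>auto simp: complex_nonpos_Reals_iff intro!: derivative_eq_intros\<close>)
    moreover have "((\<lambda>z. (4 + z) powr \<beta>) has_field_derivative \<beta> * (4 + of_real x) powr (\<beta> - 1) * 1) (at (of_real x))"
      by (rule DERIV_chain2[where g = "\<lambda>z. 4 + z", OF has_field_derivative_powr])
         (use x in \<open>auto simp: complex_nonpos_Reals_iff intro!: derivative_eq_intros\<close>)
    ultimately have "((\<lambda>z. (- z) powr \<alpha> * (4 + z) powr \<beta> * poly f z) has_field_derivative
        (\<alpha> * (- of_real x) powr (\<alpha> - 1) * (-1) * (4 + of_real x) powr \<beta>
         + \<beta> * (4 + of_real x) powr (\<beta> - 1) * 1 * (- of_real x) powr \<alpha>) * poly f (of_real x)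
         + poly (pderiv f) (of_real x) * ((- of_real x) powr \<alpha> * (4 + of_real x) powr \<beta>)) (at (of_real x))"
      by (intro DERIV_mult poly_DERIV)
    also have "(\<alpha> * (- of_real x) powr (\<alpha> - 1) * (-1) * (4 + of_real x) powr \<beta>
         + \<beta> * (4 + of_real x) powr (\<beta> - 1) * 1 * (- of_real x) powr \<alpha>) * poly f (of_real x)
         + poly (pderiv f) (of_real x) * ((- of_real x) powr \<alpha> * (4 + of_real x) powr \<beta>)
       = - (weight \<alpha> \<beta> x * g (of_real x))"
      using 1 2 by (simp add: weight_def g_def algebra_simps)
    finally have "((\<lambda>z. (- z) powr \<alpha> * (4 + z) powr \<beta> * poly f z) has_field_derivative
         - (weight \<alpha> \<beta> x * g (of_real x))) (at (of_real x))" .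
    from has_vector_derivative_real_field[OF this]
    show "(F has_vector_derivative - (weight \<alpha> \<beta> x * g (of_real x))) (at x)"
      unfolding F_def by (simp add: o_def)
  qed simp
  from has_integral_neg[OF this]
  have "((\<lambda>x. weight \<alpha> \<beta> x * g (of_real x)) has_integral 0) {-4..0}"
    by (simp add: F_def)
  then show ?thesis unfolding weighted_int_def g_def by (rule integral_unique)
qed

lemma weighted_int_add:
  assumes "Re \<alpha> > 0" "Re \<beta> > 0" "continuous_on UNIV f" "continuous_on UNIV g"
  shows "weighted_int \<alpha> \<beta> (\<lambda>x. f x + g x) = weighted_int \<alpha> \<beta> f + weighted_int \<alpha> \<beta> g"
proof -
  have "((\<lambda>x. weight \<alpha> \<beta> x * (f (of_real x) + g (of_real x))) has_integral weighted_int \<alpha> \<beta> f + weighted_int \<alpha> \<beta> g) {-4..0}"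
    unfolding distrib_left by (intro has_integral_add weighted_int_has_integral assms)
  then show ?thesis unfolding weighted_int_def[of _ _ "\<lambda>x. f x + g x"] by (rule integral_unique)
qed

lemma weighted_int_cmult: "weighted_int \<alpha> \<beta> (\<lambda>x. c * f x) = c * weighted_int \<alpha> \<beta> f"
proof -
  have "(\<lambda>x. weight \<alpha> \<beta> x * (c * f (of_real x))) = (\<lambda>x. c * (weight \<alpha> \<beta> x * f (of_real x)))" by auto
  then show ?thesis unfolding weighted_int_def by simp
qed

lemma weighted_int_linear_3:
  assumes "Re \<alpha> > 0" "Re \<beta> > 0"
  shows "weighted_int \<alpha> \<beta> (\<lambda>x. a * poly p x + b * poly q x + c * poly r x)
    = a * weighted_int \<alpha> \<beta> (poly p) + b * weighted_int \<alpha> \<beta> (poly q) + c * weighted_int \<alpha> \<beta> (poly r)"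
proof -
  have c: "continuous_on UNIV (\<lambda>x. z * poly p x)" for z :: complex and p
    by (intro continuous_intros)
  show ?thesis by (simp add: weighted_int_add[OF assms] c continuous_on_add weighted_int_cmult)
qed

section \<open>Moments of the families and orthogonality\<close>

text \<open>The Pearson identity applied to a member of the family, with the derivative and the factor \<open>x\<close> eliminated
in favour of neighbouring members. It serves twice: at \<open>\<alpha> = 1/2 + e\<close>, \<open>\<beta> = 1/2\<close> for orthogonality, and at
\<open>\<alpha> = s + e/2 - 1/4\<close>, \<open>\<beta> = 1/4\<close> for the Mellin transforms, where its middle coefficient is \<open>2 s - 1\<close>.\<close>

lemma cheb_weighted_int_recurrence:
  assumes "Re \<alpha> > 0" "Re \<beta> > 0" "e = 0 \<or> e = 1"
  shows "(of_nat (Suc m) + \<alpha> + \<beta>) * weighted_int \<alpha> \<beta> (poly (cheb e (Suc (Suc m))))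
    + (2 * \<alpha> - 2 * \<beta> - e) * weighted_int \<alpha> \<beta> (poly (cheb e (Suc m)))
    + (\<alpha> + \<beta> - of_nat (Suc m) - e) * weighted_int \<alpha> \<beta> (poly (cheb e m)) = 0"
proof -
  have "x * (4 + x) * poly (pderiv (cheb e (Suc m))) x + (\<alpha> * (4 + x) + \<beta> * x) * poly (cheb e (Suc m)) x
    = (of_nat (Suc m) + \<alpha> + \<beta>) * poly (cheb e (Suc (Suc m))) x
    + (2 * \<alpha> - 2 * \<beta> - e) * poly (cheb e (Suc m)) x
    + (\<alpha> + \<beta> - of_nat (Suc m) - e) * poly (cheb e m) x" for x
    unfolding cheb_derivative[OF assms(3)] by (simp add: algebra_simps)
  then show ?thesis
    using Pearson_integral[OF assms(1,2), of "cheb e (Suc m)"] by (simp only: weighted_int_linear_3[OF assms(1,2)])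
qed

lemma weighted_int_linear_base:
  assumes "Re \<alpha> > 0" "Re \<beta> > 0"
  shows "(\<alpha> + \<beta>) * weighted_int \<alpha> \<beta> (poly [:c, 1:]) = ((\<alpha> + \<beta>) * c - 4 * \<alpha>) * weighted_int \<alpha> \<beta> (\<lambda>_. 1)"
proof -
  have "(\<alpha> + \<beta>) * poly [:c, 1:] x
      = 1 * (x * (4 + x) * poly (pderiv 1) x + (\<alpha> * (4 + x) + \<beta> * x) * poly 1 x)
        + ((\<alpha> + \<beta>) * c - 4 * \<alpha>) * 1" for x
    by (simp add: algebra_simps)
  then have "(\<alpha> + \<beta>) * weighted_int \<alpha> \<beta> (poly [:c, 1:])
    = weighted_int \<alpha> \<beta> (\<lambda>x. 1 * (x * (4 + x) * poly (pderiv 1) x + (\<alpha> * (4 + x) + \<beta> * x) * poly 1 x)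
        + ((\<alpha> + \<beta>) * c - 4 * \<alpha>) * 1)"
    unfolding weighted_int_cmult[symmetric] by presburger
  also have "\<dots> = 1 * weighted_int \<alpha> \<beta> (\<lambda>x. x * (4 + x) * poly (pderiv 1) x + (\<alpha> * (4 + x) + \<beta> * x) * poly 1 x)
      + ((\<alpha> + \<beta>) * c - 4 * \<alpha>) * weighted_int \<alpha> \<beta> (\<lambda>_. 1)"
    unfolding weighted_int_cmult[symmetric] by (intro weighted_int_add assms continuous_intros)
  finally show ?thesis unfolding Pearson_integral[OF assms] by simp
qed

lemma weighted_int_cheb_eq_0:
  assumes e: "e = 0 \<or> e = 1"
  shows "weighted_int (1/2 + e) (1/2) (poly (cheb e (Suc m))) = 0"
proof (induction m rule: less_induct)
  case (less m)
  have pos: "Re (1/2 + e) > 0" "Re (1/2 :: complex) > 0" using e by auto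
  have nz: "of_nat n + 1 + e \<noteq> 0" for n
    using e by (auto simp: complex_eq_iff)
  show ?case
  proof (cases m)
    case 0
    have "(1/2 + e + 1/2) * (2 + e) - 4 * (1/2 + e) = 0" "1/2 + e + 1/2 \<noteq> 0"
      using e by auto
    then show ?thesis
      using weighted_int_linear_base[OF pos, of "2 + e"] unfolding 0 cheb.simps by (metis mult_eq_0_iff)
  next
    case (Suc n)
    \<comment> \<open>The induction hypothesis says nothing about index 0, but there the coefficient \<open>n\<close> vanishes.\<close>
    have "(of_nat n * weighted_int (1/2 + e) (1/2) (poly (cheb e n))) = 0"
      using less[of "n - 1"] Suc by (cases n) auto
    then have "(of_nat (Suc n) + 1 + e) * weighted_int (1/2 + e) (1/2) (poly (cheb e (Suc m))) = 0"
      using cheb_weighted_int_recurrence[OF pos e, of n] less[of n] Suc by (simp add: algebra_simps)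
    then show ?thesis using nz[of "Suc n"] by simp
  qed
qed

lemma poly_mult_pointwise: "poly (p * q) = (\<lambda>x. poly p x * poly q x)"
  by (rule ext) simp

text \<open>Since \<open>x R\<^sub>k = R\<^sub>k\<^sub>+\<^sub>1 - 2 R\<^sub>k + R\<^sub>k\<^sub>-\<^sub>1\<close>, a factor \<open>x\<close> of \<open>f\<close> can be traded for a shift of the index by at most one.
As long as the index stays positive, everything reduces to the vanishing of the plain integrals of \<open>R\<^sub>k\<close>.\<close>

lemma cheb_orthogonal:
  assumes e: "e = 0 \<or> e = 1" and f: "f = 0 \<or> degree f < k"
  shows "weighted_int (1/2 + e) (1/2) (\<lambda>x. poly (cheb e k) x * poly f x) = 0"
  using f
proof (induction f arbitrary: k)
  case 0
  then show ?case by (simp add: weighted_int_def)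
next
  case (pCons c f)
  have pos: "Re (1/2 + e) > 0" "Re (1/2 :: complex) > 0" using e by auto
  obtain m where k: "k = Suc m" using pCons by (cases k) auto
  have deg: "f = 0 \<or> degree f < m" using pCons.prems k by (auto split: if_splits)
  let ?L = "\<lambda>m. weighted_int (1/2 + e) (1/2) (\<lambda>x. poly (cheb e m) x * poly f x)"
  have "weighted_int (1/2 + e) (1/2) (\<lambda>x. poly (cheb e k) x * poly (pCons c f) x)
      = weighted_int (1/2 + e) (1/2) (\<lambda>x. c * poly (cheb e k) x + (1 * poly (cheb e (Suc k) * f) x
          + (-2) * poly (cheb e k * f) x + 1 * poly (cheb e m * f) x))"
    unfolding k by (intro arg_cong[of _ _ "weighted_int _ _"] ext) (simp add: algebra_simps)
  also have "\<dots> = c * weighted_int (1/2 + e) (1/2) (poly (cheb e k)) + (1 * ?L (Suc k) + (-2) * ?L k + 1 * ?L m)"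
    by (subst weighted_int_add, (intro pos continuous_intros)+) (simp only: weighted_int_linear_3[OF pos] weighted_int_cmult, simp only: poly_mult_pointwise)
  also have "\<dots> = 0"
    using pCons.IH[of "Suc k"] pCons.IH[of k] pCons.IH[of m] deg weighted_int_cheb_eq_0[OF e, of m] k by auto
  finally show ?case .
qed

section \<open>The Beta integral with a complex parameter\<close>

lemma norm_exp_minus_1_le:
  fixes z :: complex
  assumes "Re z \<le> 0"
  shows "norm (exp z - 1) \<le> norm z"
proof -
  have "norm (exp z - exp 0) \<le> 1 * norm (z - 0)"
    by (rule field_differentiable_bound[of "{w. Re w \<le> 0}" exp exp])
       (use assms in \<open>auto intro!: derivative_eq_intros convex_halfspace_Re_le simp: has_field_derivative_at_within\<close>)
  then show ?thesis by simp
qed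

text \<open>The factor \<open>v\<close> absorbs the logarithmic singularity at 0 in \<open>\<bar>v\<^sup>a - 1\<bar> \<le> \<bar>a\<bar> \<bar>ln v\<bar>\<close>.\<close>

lemma powr_minus_1_bound:
  fixes a :: complex and v :: real
  assumes "Re a > 0" "0 < v" "v < 1"
  shows "v * norm (exp (a * of_real (ln v)) - 1) \<le> norm a * (1 - v)"
proof -
  have "norm (exp (a * of_real (ln v)) - 1) \<le> norm (a * of_real (ln v))"
    using assms by (intro norm_exp_minus_1_le) (auto simp: mult_le_0_iff)
  also have "\<dots> = norm a * (- ln v)" using assms by (simp add: norm_mult)
  finally have "v * norm (exp (a * of_real (ln v)) - 1) \<le> norm a * (v * - ln v)"
    using assms by (metis mult.left_commute mult_left_mono less_imp_le)
  also have "v * - ln v \<le> 1 - v"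
    using ln_le_minus_one[of "1 / v"] assms by (simp add: ln_div field_simps)
  finally show ?thesis by (simp add: mult_left_mono)
qed

lemma Gamma_nonzero_right: "Re z > 0 \<Longrightarrow> Gamma z \<noteq> 0"
  by (auto simp: Gamma_eq_zero_iff elim!: nonpos_Ints_cases)

lemma pochhammer_nonzero_right: "Re z > 0 \<Longrightarrow> pochhammer z n \<noteq> 0"
  by (auto simp: pochhammer_eq_0_iff)

lemma pochhammer_ratio_tendsto:
  fixes a b :: complex
  assumes "Re a > 0" "Re b \<ge> 0"
  shows "(\<lambda>n. pochhammer a n / pochhammer (a + b) n * exp (b * of_real (ln (of_nat n))))
    \<longlonglongrightarrow> Gamma (a + b) / Gamma a"
proof (rule Lim_transform_eventually)
  show "(\<lambda>n. Gamma_series' (a + b) n / Gamma_series' a n) \<longlonglongrightarrow> Gamma (a + b) / Gamma a"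
    using assms by (intro tendsto_divide Gamma_series'_LIMSEQ Gamma_nonzero_right)
  have "Gamma_series' (a + b) n / Gamma_series' a n
      = pochhammer a n / pochhammer (a + b) n * exp (b * of_real (ln (of_nat n)))" for n
    by (simp add: Gamma_series'_def distrib_right exp_add)
  then show "\<forall>\<^sub>F n in sequentially. Gamma_series' (a + b) n / Gamma_series' a n
      = pochhammer a n / pochhammer (a + b) n * exp (b * of_real (ln (of_nat n)))" by simp
qed

context
  fixes \<beta> :: real
  assumes \<beta>: "\<beta> > 0"
begin

text \<open>Up to a constant factor this is \<open>\<integral> v\<^sup>\<alpha>\<^sup>-\<^sup>1 (1 - v)\<^sup>\<beta>\<^sup>-\<^sup>1 dv\<close> over \<open>0 < v < 1\<close>, where \<open>v = -x/4\<close>. To identify it for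
complex \<open>\<alpha>\<close>, the quotient \<open>\<phi>(\<alpha>) = scaled_beta \<alpha> \<Gamma>(\<alpha> + \<beta>) / \<Gamma>(\<alpha>)\<close> is shown to be constant: it has period 1,
and it is the limit of \<open>n\<^sup>\<beta> scaled_beta (\<alpha> + n)\<close>, whose dependence on \<open>\<alpha>\<close> disappears as \<open>n\<close> grows.\<close>

definition scaled_beta :: "complex \<Rightarrow> complex" where
  "scaled_beta \<alpha> = 4 powr (- \<alpha>) * weighted_int \<alpha> (of_real \<beta>) (\<lambda>_. 1)"

lemma scaled_beta_has_integral:
  assumes "Re \<alpha> > 0"
  shows "((\<lambda>x. 4 powr (- \<alpha>) * weight \<alpha> (of_real \<beta>) x) has_integral scaled_beta \<alpha>) {-4..0}"
  unfolding scaled_beta_def using weighted_int_has_integral[OF assms, of \<beta> "\<lambda>_. 1"] \<beta>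
  by (intro has_integral_mult_right) auto

lemma scaled_beta_Suc:
  assumes "Re \<alpha> > 0"
  shows "(\<alpha> + of_real \<beta>) * scaled_beta (\<alpha> + 1) = \<alpha> * scaled_beta \<alpha>"
proof -
  have "weighted_int \<alpha> (of_real \<beta>) (poly [:0, 1:]) = - weighted_int (\<alpha> + 1) (of_real \<beta>) (\<lambda>_. 1)"
    unfolding weighted_int_def integral_neg[symmetric] by (intro integral_cong) (simp add: weight_times_x)
  then have "(\<alpha> + of_real \<beta>) * weighted_int (\<alpha> + 1) (of_real \<beta>) (\<lambda>_. 1) = 4 * \<alpha> * weighted_int \<alpha> (of_real \<beta>) (\<lambda>_. 1)"
    using weighted_int_linear_base[of \<alpha> "of_real \<beta>" 0] assms \<beta> by (simp add: algebra_simps)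
  moreover define X :: complex where "X = 4 powr (- (\<alpha> + 1))"
  moreover have "4 powr (- \<alpha>) = X * 4"
    using powr_eq_pred_times[of 4 "- \<alpha>"] by (simp add: X_def)
  ultimately show ?thesis
    unfolding scaled_beta_def X_def[symmetric] by (metis mult.assoc mult.commute)
qed

lemma scaled_beta_add:
  assumes "Re \<alpha> > 0"
  shows "pochhammer (\<alpha> + of_real \<beta>) n * scaled_beta (\<alpha> + of_nat n) = pochhammer \<alpha> n * scaled_beta \<alpha>"
proof (induction n)
  case (Suc n)
  have "pochhammer (\<alpha> + of_real \<beta>) (Suc n) * scaled_beta (\<alpha> + of_nat (Suc n))
    = pochhammer (\<alpha> + of_real \<beta>) n * ((\<alpha> + of_nat n + of_real \<beta>) * scaled_beta (\<alpha> + of_nat n + 1))"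
    by (simp add: pochhammer_Suc algebra_simps)
  also have "\<dots> = (\<alpha> + of_nat n) * (pochhammer (\<alpha> + of_real \<beta>) n * scaled_beta (\<alpha> + of_nat n))"
    by (subst scaled_beta_Suc) (use assms in simp_all)
  finally show ?case unfolding Suc by (simp add: pochhammer_Suc)
qed simp

text \<open>The factor \<open>n\<^sup>\<beta>\<close> is written as an exponential to match the Gauss product for the Gamma function.\<close>

lemma scaled_beta_asymptotics:
  assumes "Re \<alpha> > 0"
  shows "(\<lambda>n. scaled_beta (\<alpha> + of_nat n) * exp (of_real \<beta> * of_real (ln (of_nat n))))
     \<longlonglongrightarrow> scaled_beta \<alpha> * Gamma (\<alpha> + of_real \<beta>) / Gamma \<alpha>"
proof -
  have "scaled_beta (\<alpha> + of_nat n) = scaled_beta \<alpha> * (pochhammer \<alpha> n / pochhammer (\<alpha> + of_real \<beta>) n)" for n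
  proof -
    have "pochhammer (\<alpha> + of_real \<beta>) n \<noteq> 0"
      using assms \<beta> by (intro pochhammer_nonzero_right) simp
    then show ?thesis using scaled_beta_add[OF assms, of n] by (simp add: field_simps)
  qed
  then show ?thesis
    using tendsto_mult[OF tendsto_const pochhammer_ratio_tendsto[of \<alpha> "of_real \<beta>"], of "scaled_beta \<alpha>"] assms \<beta>
    by (simp add: mult.assoc)
qed

lemma scaled_beta_integrand:
  assumes "x \<in> {-4<..<0}"
  shows "4 powr (- \<alpha>) * weight \<alpha> (of_real \<beta>) x
    = exp ((\<alpha> - 1) * of_real (ln (- x / 4))) * of_real ((4 + x) powr (\<beta> - 1) / 4)"
proof -
  have "of_real (4 + x) powr (of_real \<beta> - 1) = complex_of_real ((4 + x) powr (\<beta> - 1))"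
    using assms powr_of_real[of "4 + x" "\<beta> - 1"] by simp
  moreover have "4 powr (- \<alpha>) * of_real (- x) powr (\<alpha> - 1) = exp ((\<alpha> - 1) * of_real (ln (- x / 4))) / 4"
  proof -
    have "4 powr (- \<alpha>) = exp (- \<alpha> * of_real (ln 4))"
      using Ln_of_real[of 4] by (simp add: powr_def)
    moreover have "of_real (- x) powr (\<alpha> - 1) = exp ((\<alpha> - 1) * of_real (ln (- x)))"
      using assms Ln_of_real[of "- x"] by (simp add: powr_def)
    moreover have "exp (of_real (ln 4)) = (4 :: complex)"
      by (subst exp_of_real) simp
    moreover have "ln (- x) = ln (- x / 4) + ln 4" using assms ln_div[of "- x" 4] by simp
    moreover have "exp (- \<alpha> * l) * exp ((\<alpha> - 1) * (L + l)) = exp ((\<alpha> - 1) * L) / exp l" for L l :: complex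
      unfolding exp_add[symmetric] exp_diff[symmetric] by (simp add: algebra_simps)
    ultimately show ?thesis by simp
  qed
  ultimately show ?thesis by (simp add: weight_def mult.assoc)
qed

text \<open>After extracting \<open>v\<^sup>n\<close> the two integrands compare pointwise. The right-hand side is a difference of
consecutive values, which is negligible against \<open>n\<^sup>-\<^sup>\<beta>\<close> because both have the same leading asymptotics. The
shift by 2 provides the spare factor \<open>v\<close> used in the pointwise bound.\<close>

lemma scaled_beta_difference_bound:
  assumes "Re \<alpha> > 0"
  shows "norm (scaled_beta (\<alpha> + 2 + of_nat n) - scaled_beta (2 + of_nat n))
    \<le> norm \<alpha> * norm (scaled_beta (1 + of_nat n) - scaled_beta (2 + of_nat n))"
proof -
  define h where "h = (\<lambda>a x. 4 powr (- a) * weight a (of_real \<beta>) x)"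
  have h: "(h a has_integral scaled_beta a) {-4..0}" if "Re a > 0" for a
    unfolding h_def using scaled_beta_has_integral[OF that] .
  have 1: "((\<lambda>x. h (\<alpha> + 2 + of_nat n) x - h (2 + of_nat n) x) has_integral
      scaled_beta (\<alpha> + 2 + of_nat n) - scaled_beta (2 + of_nat n)) {-4..0}"
    using assms by (intro has_integral_diff h) auto
  have "((\<lambda>x. h (1 + of_nat n) x - h (2 + of_nat n) x) has_integral
      scaled_beta (1 + of_nat n) - scaled_beta (2 + of_nat n)) {-4..0}"
    by (intro has_integral_diff h) auto
  from has_integral_mult_right[OF has_integral_Re[OF this]]
  have 2: "((\<lambda>x. norm \<alpha> * Re (h (1 + of_nat n) x - h (2 + of_nat n) x)) has_integral
      norm \<alpha> * Re (scaled_beta (1 + of_nat n) - scaled_beta (2 + of_nat n))) {-4..0}" .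
  have "norm (h (\<alpha> + 2 + of_nat n) x - h (2 + of_nat n) x)
      \<le> norm \<alpha> * Re (h (1 + of_nat n) x - h (2 + of_nat n) x)" if "x \<in> {-4..0}" for x
  proof (cases "x \<in> {-4<..<0}")
    case True
    define v where "v = - x / 4"
    have v: "0 < v" "v < 1" using True by (auto simp: v_def)
    define w where "w = v ^ n * ((4 + x) powr (\<beta> - 1) / 4)"
    have "w \<ge> 0" using v by (simp add: w_def)
    have h': "h (a + 1 + of_nat n) x = exp (a * of_real (ln v)) * of_real w" for a
    proof -
      have "exp (of_nat n * of_real (ln v)) = complex_of_real (v ^ n)"
        using v by (simp add: exp_of_nat_mult exp_of_real)
      then show ?thesis
        unfolding h_def scaled_beta_integrand[OF True] w_def v_def[symmetric]
        by (simp add: distrib_right exp_add)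
    qed
    have ev: "exp (of_real (ln v)) = complex_of_real v" using v by (simp add: exp_of_real)
    have "h (\<alpha> + 2 + of_nat n) x - h (2 + of_nat n) x = of_real w * (of_real v * (exp (\<alpha> * of_real (ln v)) - 1))"
      using h'[of "\<alpha> + 1"] h'[of 1] ev by (simp add: distrib_right exp_add algebra_simps)
    moreover have "h (1 + of_nat n) x - h (2 + of_nat n) x = of_real (w * (1 - v))"
      using h'[of 0] h'[of 1] ev by (simp add: algebra_simps)
    ultimately show ?thesis
      using mult_left_mono[OF powr_minus_1_bound[OF assms v] \<open>w \<ge> 0\<close>] v \<open>w \<ge> 0\<close>
      by (simp add: norm_mult mult.left_commute)
  next
    case False
    \<comment> \<open>Powers of 0 are 0 by convention, so both sides vanish at the endpoints.\<close>
    with that have "x = -4 \<or> x = 0" by auto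
    then show ?thesis by (auto simp: h_def weight_def)
  qed
  then have "norm (scaled_beta (\<alpha> + 2 + of_nat n) - scaled_beta (2 + of_nat n))
      \<le> norm \<alpha> * Re (scaled_beta (1 + of_nat n) - scaled_beta (2 + of_nat n))"
    using integral_norm_bound_integral[OF has_integral_integrable[OF 1] has_integral_integrable[OF 2]]
    unfolding integral_unique[OF 1] integral_unique[OF 2] by blast
  also have "\<dots> \<le> norm \<alpha> * norm (scaled_beta (1 + of_nat n) - scaled_beta (2 + of_nat n))"
    by (intro mult_left_mono complex_Re_le_cmod) auto
  finally show ?thesis .
qed

lemma scaled_beta_Gamma_periodic:
  assumes "Re \<alpha> > 0"
  shows "scaled_beta (\<alpha> + 1) * Gamma (\<alpha> + 1 + of_real \<beta>) / Gamma (\<alpha> + 1)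
    = scaled_beta \<alpha> * Gamma (\<alpha> + of_real \<beta>) / Gamma \<alpha>"
proof -
  have "\<alpha> \<notin> \<int>\<^sub>\<le>\<^sub>0" "\<alpha> + of_real \<beta> \<notin> \<int>\<^sub>\<le>\<^sub>0" "\<alpha> \<noteq> 0"
    using assms \<beta> by (auto elim!: nonpos_Ints_cases simp: complex_eq_iff)
  then have "Gamma (\<alpha> + 1) = \<alpha> * Gamma \<alpha>"
    "Gamma (\<alpha> + 1 + of_real \<beta>) = (\<alpha> + of_real \<beta>) * Gamma (\<alpha> + of_real \<beta>)"
    using Gamma_plus1[of \<alpha>] Gamma_plus1[of "\<alpha> + of_real \<beta>"] by (auto simp: add_ac)
  then have "scaled_beta (\<alpha> + 1) * Gamma (\<alpha> + 1 + of_real \<beta>) / Gamma (\<alpha> + 1)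
      = ((\<alpha> + of_real \<beta>) * scaled_beta (\<alpha> + 1)) * Gamma (\<alpha> + of_real \<beta>) / (\<alpha> * Gamma \<alpha>)"
    by (simp only: mult_ac)
  also have "\<dots> = scaled_beta \<alpha> * Gamma (\<alpha> + of_real \<beta>) / Gamma \<alpha>"
    unfolding scaled_beta_Suc[OF assms] using \<open>\<alpha> \<noteq> 0\<close> by simp
  finally show ?thesis .
qed

lemma scaled_beta_eq_Gamma_ratio:
  assumes "Re \<alpha> > 0"
  shows "scaled_beta \<alpha> * Gamma (\<alpha> + of_real \<beta>) / Gamma \<alpha> = scaled_beta 1 * Gamma (1 + of_real \<beta>)"
proof -
  define \<phi> where "\<phi> = (\<lambda>a. scaled_beta a * Gamma (a + of_real \<beta>) / Gamma a)"
  define E where "E = (\<lambda>n. exp (of_real \<beta> * of_real (ln (of_nat n))) :: complex)"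
  have lim: "(\<lambda>n. scaled_beta (a + of_nat n) * E n) \<longlonglongrightarrow> \<phi> a" if "Re a > 0" for a
    unfolding E_def \<phi>_def using scaled_beta_asymptotics[OF that] .
  have per: "\<phi> (a + 1) = \<phi> a" if "Re a > 0" for a
    unfolding \<phi>_def using scaled_beta_Gamma_periodic[OF that] .
  have "(\<lambda>n. scaled_beta (1 + of_nat n) * E n - scaled_beta (2 + of_nat n) * E n) \<longlonglongrightarrow> \<phi> 1 - \<phi> 2"
    by (intro tendsto_diff lim) auto
  then have "(\<lambda>n. (scaled_beta (1 + of_nat n) - scaled_beta (2 + of_nat n)) * E n) \<longlonglongrightarrow> 0"
    using per[of 1] by (simp add: left_diff_distrib)
  from tendsto_mult_right_zero[OF tendsto_norm_zero[OF this], of "norm \<alpha>"]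
  have "(\<lambda>n. (scaled_beta (\<alpha> + 2 + of_nat n) - scaled_beta (2 + of_nat n)) * E n) \<longlonglongrightarrow> 0"
  proof (rule Lim_null_comparison[rotated], intro always_eventually allI)
    fix n
    show "norm ((scaled_beta (\<alpha> + 2 + of_nat n) - scaled_beta (2 + of_nat n)) * E n)
      \<le> norm \<alpha> * norm ((scaled_beta (1 + of_nat n) - scaled_beta (2 + of_nat n)) * E n)"
      using mult_right_mono[OF scaled_beta_difference_bound[OF assms, of n], of "norm (E n)"]
      by (simp add: norm_mult mult.assoc)
  qed
  moreover have "(\<lambda>n. scaled_beta (\<alpha> + 2 + of_nat n) * E n - scaled_beta (2 + of_nat n) * E n) \<longlonglongrightarrow> \<phi> (\<alpha> + 2) - \<phi> 2"
    using assms by (intro tendsto_diff lim) auto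
  ultimately have "\<phi> (\<alpha> + 2) = \<phi> 2"
    using LIMSEQ_unique by (fastforce simp: left_diff_distrib)
  moreover have "\<phi> (\<alpha> + 2) = \<phi> \<alpha>" "\<phi> 2 = \<phi> 1"
    using per[of \<alpha>] per[of "\<alpha> + 1"] per[of 1] assms by (auto simp: add.assoc)
  ultimately show ?thesis by (simp add: \<phi>_def)
qed

lemma scaled_beta_1_nonzero: "scaled_beta 1 \<noteq> 0"
proof -
  have "((\<lambda>x. weight 1 (of_real \<beta>) x * 1) has_integral
      complex_of_real ((4 + 0) powr \<beta> / \<beta>) - complex_of_real ((4 + -4) powr \<beta> / \<beta>)) {-4..0}"
  proof (rule fundamental_theorem_of_calculus_interior)
    show "continuous_on {-4..0} (\<lambda>x. complex_of_real ((4 + x) powr \<beta> / \<beta>))"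
      using \<beta> by (intro continuous_intros continuous_on_powr') auto
    fix x :: real assume x: "x \<in> {-4<..<0}"
    have "((\<lambda>x. (4 + x) powr \<beta> / \<beta>) has_real_derivative (4 + x) powr (\<beta> - 1)) (at x)"
      using x \<beta> by (auto intro!: derivative_eq_intros simp: powr_diff)
    moreover have "weight 1 (of_real \<beta>) x * 1 = of_real ((4 + x) powr (\<beta> - 1))"
      using x powr_of_real[of "4 + x" "\<beta> - 1"] by (simp add: weight_def)
    ultimately show "((\<lambda>x. complex_of_real ((4 + x) powr \<beta> / \<beta>)) has_vector_derivative weight 1 (of_real \<beta>) x * 1) (at x)"
      by (metis has_vector_derivative_of_real has_real_derivative_iff_has_vector_derivative)
  qed simp
  then have "weighted_int 1 (of_real \<beta>) (\<lambda>_. 1) = complex_of_real (4 powr \<beta> / \<beta>)"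
    unfolding weighted_int_def by (simp add: integral_unique)
  then show ?thesis using \<beta> by (simp add: scaled_beta_def)
qed

end

lemma weighted_int_1_eq_Gamma:
  assumes "\<beta> > 0"
  obtains \<kappa> where "\<kappa> \<noteq> 0"
    "\<And>\<alpha>. Re \<alpha> > 0 \<Longrightarrow> weighted_int \<alpha> (of_real \<beta>) (\<lambda>_. 1) = \<kappa> * 4 powr \<alpha> * Gamma \<alpha> / Gamma (\<alpha> + of_real \<beta>)"
proof
  show "scaled_beta \<beta> 1 * Gamma (1 + of_real \<beta>) \<noteq> 0"
    using scaled_beta_1_nonzero[OF assms] Gamma_nonzero_right[of "1 + of_real \<beta>"] assms by simp
  fix \<alpha> :: complex assume \<alpha>: "Re \<alpha> > 0"
  show "weighted_int \<alpha> (of_real \<beta>) (\<lambda>_. 1) = scaled_beta \<beta> 1 * Gamma (1 + of_real \<beta>) * 4 powr \<alpha> * Gamma \<alpha> / Gamma (\<alpha> + of_real \<beta>)"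
  proof -
    have "4 powr (- \<alpha>) * 4 powr \<alpha> = (1 :: complex)" by (simp add: powr_minus)
    then have "weighted_int \<alpha> (of_real \<beta>) (\<lambda>_. 1) = scaled_beta \<beta> \<alpha> * 4 powr \<alpha>"
      by (simp add: scaled_beta_def[OF assms])
    also have "scaled_beta \<beta> \<alpha> = scaled_beta \<beta> 1 * Gamma (1 + of_real \<beta>) * Gamma \<alpha> / Gamma (\<alpha> + of_real \<beta>)"
      unfolding scaled_beta_eq_Gamma_ratio[OF assms \<alpha>, symmetric]
      using Gamma_nonzero_right[OF \<alpha>] Gamma_nonzero_right[of "\<alpha> + of_real \<beta>"] assms \<alpha> by simp
    finally show ?thesis by simp
  qed
qed

section \<open>The Mellin transforms and their polynomial factors\<close>

lemma of_real_powr_nonpos: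
  "x \<le> 0 \<Longrightarrow> complex_of_real x powr w = exp (\<i> * of_real pi * w) * of_real (- x) powr w"
  using powr_negative_real[of x w] by (cases "x = 0") auto

text \<open>The half-plane argument needs a real sequence, whereas \<open>e\<close> is complex.\<close>

definition crit_shift :: "complex \<Rightarrow> nat \<Rightarrow> real" where
  "crit_shift e m = real m + 1/2 + Re e / 2"

text \<open>Multiplying the moments by the Pochhammer symbol turns their three-term recurrence into the one for
\<open>crit_poly\<close>: for \<open>c = m + 1/2 + e/2\<close> the coefficient \<open>(s - 1 - e/2 - m) (s + e/2 + m)\<close> is \<open>(s - 1/2)\<^sup>2 - c\<^sup>2\<close>.
The sign \<open>(-1)\<^sup>m\<close> accounts for the opposite sign of the middle term.\<close>

lemma weighted_int_cheb_eq_crit: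
  assumes e: "e = 0 \<or> e = 1" and s: "Re (s + e/2 - 1/4) > 0"
  shows "weighted_int (s + e/2 - 1/4) (1/4) (poly (cheb e m)) * pochhammer (s + e/2) m
    = (2 - e) * (-1) ^ m * poly (crit_poly (crit_shift e) m) s * weighted_int (s + e/2 - 1/4) (1/4) (\<lambda>_. 1)"
proof -
  define M where "M = (\<lambda>m. weighted_int (s + e/2 - 1/4) (1/4) (poly (cheb e m)))"
  define I where "I = weighted_int (s + e/2 - 1/4) (1/4) (\<lambda>_. 1)"
  have pos: "Re (1/4 :: complex) > 0" by simp
  have rec: "(s + e/2 + of_nat (Suc m)) * M (Suc (Suc m))
      = - (2 * s - 1) * M (Suc m) - (s - 1 - e/2 - of_nat m) * M m" for m
    using cheb_weighted_int_recurrence[OF s pos e, of m] by (simp add: M_def algebra_simps)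
  have sq: "of_real ((crit_shift e m)\<^sup>2) = (of_nat m + 1/2 + e/2)\<^sup>2" for m
    using e by (auto simp: crit_shift_def)
  have "M m * pochhammer (s + e/2) m = (2 - e) * (-1) ^ m * poly (crit_poly (crit_shift e) m) s * I"
  proof (induction m rule: induct_nat_012)
    case 0
    have "poly (cheb e 0) = (\<lambda>_. (2 - e) * 1)" by auto
    then show ?case unfolding M_def I_def by (simp only: weighted_int_cmult) simp
  next
    case 1
    have "(s + e/2) * M (Suc 0) = ((s + e/2) * (2 + e) - 4 * (s + e/2 - 1/4)) * I"
      using weighted_int_linear_base[OF s pos, of "2 + e"] by (simp add: M_def I_def)
    then show ?case using e by (auto simp: algebra_simps)
  next
    case (ge2 m)
    define p where "p = pochhammer (s + e/2) m"
    define k where "k = (\<lambda>n. poly (crit_poly (crit_shift e) n) s)"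
    have p: "pochhammer (s + e/2) (Suc m) = p * (s + e/2 + of_nat m)"
      "pochhammer (s + e/2) (Suc (Suc m)) = p * (s + e/2 + of_nat m) * (s + e/2 + of_nat (Suc m))"
      by (simp_all add: p_def pochhammer_Suc)
    have "M (Suc (Suc m)) * pochhammer (s + e/2) (Suc (Suc m))
        = p * (s + e/2 + of_nat m) * ((s + e/2 + of_nat (Suc m)) * M (Suc (Suc m)))"
      unfolding p by simp
    also have "\<dots> = - (2 * s - 1) * (M (Suc m) * pochhammer (s + e/2) (Suc m))
        - (s - 1 - e/2 - of_nat m) * (s + e/2 + of_nat m) * (M m * p)"
    proof -
      have "p * z * (- A * x - B * y) = - A * (x * (p * z)) - B * z * (y * p)" for z A B x y
        by (simp add: algebra_simps)
      then show ?thesis unfolding rec p .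
    qed
    also have "\<dots> = (2 - e) * (-1) ^ m * I *
       (2 * (s - 1/2) * k (Suc m) - (s - 1 - e/2 - of_nat m) * (s + e/2 + of_nat m) * k m)"
      unfolding p_def ge2 k_def by (simp add: algebra_simps)
    also have "(s - 1 - e/2 - of_nat m) * (s + e/2 + of_nat m) = (s - 1/2)\<^sup>2 - (of_nat m + 1/2 + e/2)\<^sup>2"
      by (simp add: power2_eq_square field_simps)
    also have "2 * (s - 1/2) * k (Suc m) - \<dots> * k m = k (Suc (Suc m))"
      unfolding k_def poly_crit_poly_rec sq ..
    finally show ?case by (simp add: k_def)
  qed
  then show ?thesis unfolding M_def I_def .
qed

lemma weighted_int_cheb_eq_Gamma:
  assumes e: "e = 0 \<or> e = 1"
  obtains C where "C \<noteq> 0"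
    "\<And>s. Re (s + e/2 - 1/4) > 0 \<Longrightarrow> weighted_int (s + e/2 - 1/4) (1/4) (poly (cheb e m))
       = C * 4 powr s * poly (crit_poly (crit_shift e) m) s
         * (Gamma (s + e/2 - 1/4) / Gamma (s + e/2 + of_nat m))"
proof -
  obtain \<kappa> where "\<kappa> \<noteq> 0" and \<kappa>:
    "\<And>\<alpha>. Re \<alpha> > 0 \<Longrightarrow> weighted_int \<alpha> (1/4) (\<lambda>_. 1) = \<kappa> * 4 powr \<alpha> * Gamma \<alpha> / Gamma (\<alpha> + 1/4)"
    using weighted_int_1_eq_Gamma[of "1/4"] by auto
  show ?thesis
  proof
    show "(2 - e) * (-1) ^ m * \<kappa> * 4 powr (e/2 - 1/4) \<noteq> 0" using \<open>\<kappa> \<noteq> 0\<close> e by auto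
    fix s assume s: "Re (s + e/2 - 1/4) > 0"
    define z where "z = s + e/2"
    have z: "Re z > 0" using s by (simp add: z_def)
    have "z \<notin> \<int>\<^sub>\<le>\<^sub>0" using z by (auto elim!: nonpos_Ints_cases)
    then have poch: "pochhammer z m = Gamma (z + of_nat m) / Gamma z" by (rule pochhammer_Gamma)
    have pow: "4 powr (z - 1/4) = 4 powr s * (4 powr (e/2 - 1/4) :: complex)"
      unfolding powr_add[symmetric] z_def by (simp add: algebra_simps)
    have "weighted_int (z - 1/4) (1/4) (poly (cheb e m)) =
        (2 - e) * (-1) ^ m * poly (crit_poly (crit_shift e) m) s * weighted_int (z - 1/4) (1/4) (\<lambda>_. 1) / pochhammer z m"
      using weighted_int_cheb_eq_crit[OF e s, of m] pochhammer_nonzero_right[OF z, of m]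
      unfolding z_def by (simp add: nonzero_eq_divide_eq)
    also have "\<dots> = (2 - e) * (-1) ^ m * \<kappa> * 4 powr (e/2 - 1/4) * 4 powr s * poly (crit_poly (crit_shift e) m) s
         * (Gamma (z - 1/4) / Gamma (z + of_nat m))"
      using \<kappa>[of "z - 1/4"] s Gamma_nonzero_right[OF z] unfolding poch pow by (simp add: z_def)
    finally show "weighted_int (s + e/2 - 1/4) (1/4) (poly (cheb e m)) =
        (2 - e) * (-1) ^ m * \<kappa> * 4 powr (e/2 - 1/4) * 4 powr s * poly (crit_poly (crit_shift e) m) s
         * (Gamma (s + e/2 - 1/4) / Gamma (s + e/2 + of_nat m))" unfolding z_def .
  qed
qed

lemma mellin_integrand:
  assumes "x \<in> {-4..0}"
  shows "f * complex_of_real x powr (\<alpha> - 1) / of_real (4 + x) powr (3/4)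
    = exp (\<i> * of_real pi * (\<alpha> - 1)) * (weight \<alpha> (1/4) x * f)"
  using assms by (simp add: of_real_powr_nonpos weight_def powr_minus_divide)

lemma mellin_P_eq: "mellin_P m s = (-1) powr (s + 5/4) * weighted_int (s + 1/4) (1/4) (poly (cheb 1 m))"
proof -
  \<comment> \<open>The exponents \<open>s + 5/4\<close> and \<open>s - 3/4\<close> differ by a full turn.\<close>
  have "(-1) powr (s + 5/4) = exp (\<i> * of_real pi * (s - 3/4) + of_real (2 * pi) * \<i>)"
    unfolding powr_minus_one by (simp add: algebra_simps)
  then have ph: "(-1) powr (s + 5/4) = exp (\<i> * of_real pi * (s + 1/4 - 1))"
    by (simp add: exp_add)
  show ?thesis
    unfolding mellin_P_def weighted_int_def ph P_eq_cheb integral_mult_right[symmetric]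
    using mellin_integrand[where \<alpha> = "s + 1/4"] by (intro integral_cong) simp
qed

lemma mellin_Q_eq: "mellin_Q m s = (-1) powr (s + 3/4) * weighted_int (s - 1/4) (1/4) (poly (cheb 0 m))"
proof -
  \<comment> \<open>The exponents \<open>s + 3/4\<close> and \<open>s - 5/4\<close> differ by a full turn.\<close>
  have "(-1) powr (s + 3/4) = exp (\<i> * of_real pi * (s - 5/4) + of_real (2 * pi) * \<i>)"
    unfolding powr_minus_one by (simp add: algebra_simps)
  then have ph: "(-1) powr (s + 3/4) = exp (\<i> * of_real pi * (s - 1/4 - 1))"
    by (simp add: exp_add)
  show ?thesis
    unfolding mellin_Q_def weighted_int_def ph Q_eq_cheb integral_mult_right[symmetric]
    using mellin_integrand[where \<alpha> = "s - 1/4"] by (intro integral_cong) simp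
qed

lemma is_factor_P_crit: "is_factor_P m (crit_poly (crit_shift 1) m)"
proof -
  obtain C where "C \<noteq> 0" and C: "\<And>s. Re (s + 1/2 - 1/4) > 0 \<Longrightarrow> weighted_int (s + 1/2 - 1/4) (1/4) (poly (cheb 1 m))
       = C * 4 powr s * poly (crit_poly (crit_shift 1) m) s
         * (Gamma (s + 1/2 - 1/4) / Gamma (s + 1/2 + of_nat m))"
    using weighted_int_cheb_eq_Gamma[of 1 m] by auto
  have "mellin_P m s = C / (4 powr (- of_nat m - 1) * Gamma (1/4)) * ((-1) powr (s + 5/4) * 4 powr s * 4 powr (- of_nat m - 1) * Gamma (1/4)
       * poly (crit_poly (crit_shift 1) m) s * (Gamma (s + 1/4) / Gamma (s + of_nat (2*m+1) / 2)))" if s: "Re s > -1/4" for s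
  proof -
    have "weighted_int (s + 1/4) (1/4) (poly (cheb 1 m)) = C * 4 powr s * poly (crit_poly (crit_shift 1) m) s
         * (Gamma (s + 1/4) / Gamma (s + of_nat (2*m+1) / 2))"
      using C[of s] s by (simp add: add_divide_distrib add_ac)
    then show ?thesis
      unfolding mellin_P_eq using Gamma_nonzero_right[of "1/4"] by simp
  qed
  moreover have "C / (4 powr (- of_nat m - 1) * Gamma (1/4)) \<noteq> 0"
    using \<open>C \<noteq> 0\<close> Gamma_nonzero_right[of "1/4"] by simp
  ultimately show ?thesis unfolding is_factor_P_def by blast
qed

lemma is_factor_Q_crit: "is_factor_Q m (crit_poly (crit_shift 0) m)"
proof -
  obtain C where "C \<noteq> 0" and C: "\<And>s. Re (s - 1/4) > 0 \<Longrightarrow> weighted_int (s - 1/4) (1/4) (poly (cheb 0 m))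
       = C * 4 powr s * poly (crit_poly (crit_shift 0) m) s
         * (Gamma (s - 1/4) / Gamma (s + of_nat m))"
    using weighted_int_cheb_eq_Gamma[of 0 m] by auto
  have "mellin_Q m s = C * 4 / Gamma (5/4) * ((-1) powr (s + 3/4) * 4 powr (s - 1) * Gamma (5/4)
       * poly (crit_poly (crit_shift 0) m) s * (Gamma (s - 1/4) / Gamma (s + of_nat m)))" if s: "Re s > 1/4" for s
    unfolding mellin_Q_eq using C[of s] s Gamma_nonzero_right[of "5/4"] powr_eq_pred_times[of 4 s] by simp
  moreover have "C * 4 / Gamma (5/4) \<noteq> 0"
    using \<open>C \<noteq> 0\<close> Gamma_nonzero_right[of "5/4"] by simp
  ultimately show ?thesis unfolding is_factor_Q_def by blast
qed

text \<open>A half-plane is infinite, so it determines a polynomial; this makes the factors unique up to scaling.\<close>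

lemma poly_proportional_on_halfplane:
  fixes p q :: "complex poly"
  assumes "c \<noteq> 0" "d \<noteq> 0"
    and eq: "\<And>s. Re s > r \<Longrightarrow> c * (g s * poly p s) = d * (g s * poly q s)"
    and g: "\<And>s. Re s > r \<Longrightarrow> g s \<noteq> 0"
  obtains k where "k \<noteq> 0" "p = smult k q"
proof
  show "d / c \<noteq> 0" using assms by simp
  have "poly (smult c p - smult d q) s = 0" if "Re s > r" for s
    using eq[OF that] g[OF that] by simp
  then have "{s. Re s > r} \<subseteq> {s. poly (smult c p - smult d q) s = 0}" by blast
  moreover have "infinite {s. Re s > r}"
  proof -
    have "complex_of_real (r + 1) \<in> {s. Re s > r}" by simp
    then show ?thesis using finite_imp_not_open[of "{s. Re s > r}"] open_halfspace_Re_gt by blast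
  qed
  ultimately have "smult c p - smult d q = 0"
    using poly_roots_finite finite_subset by blast
  then have "smult (inverse c) (smult c p) = smult (inverse c) (smult d q)" by simp
  then show "p = smult (d / c) q" using \<open>c \<noteq> 0\<close> by (simp add: field_simps)
qed

lemma is_factor_P_unique:
  assumes "is_factor_P m p" "is_factor_P m q"
  obtains k where "k \<noteq> 0" "p = smult k q"
proof -
  define g where "g = (\<lambda>s. (-1) powr (s + 5/4) * 4 powr s * 4 powr (- of_nat m - 1) * Gamma (1/4)
       * (Gamma (s + 1/4) / Gamma (s + of_nat (2*m+1) / 2)) :: complex)"
  obtain c where "c \<noteq> 0" and c: "\<forall>s. Re s > -1/4 \<longrightarrow> mellin_P m s = c * ((-1) powr (s + 5/4) * 4 powr s * 4 powr (- of_nat m - 1) * Gamma (1/4)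
       * poly p s * (Gamma (s + 1/4) / Gamma (s + of_nat (2*m+1) / 2)))"
    using assms(1) unfolding is_factor_P_def by blast
  obtain d where "d \<noteq> 0" and d: "\<forall>s. Re s > -1/4 \<longrightarrow> mellin_P m s = d * ((-1) powr (s + 5/4) * 4 powr s * 4 powr (- of_nat m - 1) * Gamma (1/4)
       * poly q s * (Gamma (s + 1/4) / Gamma (s + of_nat (2*m+1) / 2)))"
    using assms(2) unfolding is_factor_P_def by blast
  have eq: "c * (g s * poly p s) = d * (g s * poly q s)" if "Re s > -1/4" for s
  proof -
    have "mellin_P m s = c * (g s * poly p s)" "mellin_P m s = d * (g s * poly q s)"
      using c[rule_format, OF that] d[rule_format, OF that] by (simp_all only: g_def mult_ac)
    from trans[OF this(1)[symmetric] this(2)] show ?thesis .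
  qed
  have g: "g s \<noteq> 0" if "Re s > -1/4" for s
  proof -
    have "Re (s + of_nat (2*m+1) / 2) > 0" using that by (simp add: add_divide_distrib)
    from Gamma_nonzero_right[OF this] show ?thesis
      using that Gamma_nonzero_right[of "1/4"] Gamma_nonzero_right[of "s + 1/4"] by (simp add: g_def)
  qed
  show ?thesis
    by (rule poly_proportional_on_halfplane[where r = "-1/4", OF \<open>c \<noteq> 0\<close> \<open>d \<noteq> 0\<close> eq g])
       (auto intro: that)
qed

lemma is_factor_Q_unique:
  assumes "is_factor_Q m p" "is_factor_Q m q"
  obtains k where "k \<noteq> 0" "p = smult k q"
proof -
  define g where "g = (\<lambda>s. (-1) powr (s + 3/4) * 4 powr (s - 1) * Gamma (5/4)
       * (Gamma (s - 1/4) / Gamma (s + of_nat m)) :: complex)"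
  obtain c where "c \<noteq> 0" and c: "\<forall>s. Re s > 1/4 \<longrightarrow> mellin_Q m s = c * ((-1) powr (s + 3/4) * 4 powr (s - 1) * Gamma (5/4)
       * poly p s * (Gamma (s - 1/4) / Gamma (s + of_nat m)))"
    using assms(1) unfolding is_factor_Q_def by blast
  obtain d where "d \<noteq> 0" and d: "\<forall>s. Re s > 1/4 \<longrightarrow> mellin_Q m s = d * ((-1) powr (s + 3/4) * 4 powr (s - 1) * Gamma (5/4)
       * poly q s * (Gamma (s - 1/4) / Gamma (s + of_nat m)))"
    using assms(2) unfolding is_factor_Q_def by blast
  have eq: "c * (g s * poly p s) = d * (g s * poly q s)" if "Re s > 1/4" for s
  proof -
    have "mellin_Q m s = c * (g s * poly p s)" "mellin_Q m s = d * (g s * poly q s)"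
      using c[rule_format, OF that] d[rule_format, OF that] by (simp_all only: g_def mult_ac)
    from trans[OF this(1)[symmetric] this(2)] show ?thesis .
  qed
  have g: "g s \<noteq> 0" if "Re s > 1/4" for s
    using that Gamma_nonzero_right[of "5/4"] Gamma_nonzero_right[of "s - 1/4"]
      Gamma_nonzero_right[of "s + of_nat m"] by (simp add: g_def)
  show ?thesis
    by (rule poly_proportional_on_halfplane[where r = "1/4", OF \<open>c \<noteq> 0\<close> \<open>d \<noteq> 0\<close> eq g])
       (auto intro: that)
qed

lemma smult_crit_properties:
  assumes "k \<noteq> 0" "p = smult k (crit_poly c m)"
  shows "((\<forall>s. poly p s = poly p (1 - s)) \<or> (\<forall>s. poly p s = - poly p (1 - s)))
     \<and> (\<forall>s. poly p s = 0 \<longrightarrow> Re s = 1/2)"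
proof
  show "(\<forall>s. poly p s = poly p (1 - s)) \<or> (\<forall>s. poly p s = - poly p (1 - s))"
    using assms(2) by (cases "even m") (auto simp: crit_reflect)
  show "\<forall>s. poly p s = 0 \<longrightarrow> Re s = 1/2"
    using assms crit_zero_imp_critical_line by auto
qed

lemma cheb_orthogonal_has_integral:
  assumes e: "e = 0 \<or> e = 1" and f: "f = 0 \<or> degree f < k"
  shows "((\<lambda>x::real. of_real x powr (e - 1/2) * of_real (4 + x) powr (-1/2)
              * poly (cheb e k) (of_real x) * poly f (of_real x)) has_integral 0) {-4..0}"
proof -
  have "Re (1/2 + e) > 0" using e by auto
  then have "((\<lambda>x. weight (1/2 + e) (1/2) x * (poly (cheb e k) (of_real x) * poly f (of_real x))) has_integral 0) {-4..0}"
    using weighted_int_has_integral[of "1/2 + e" "1/2" "\<lambda>x. poly (cheb e k) x * poly f x"] cheb_orthogonal[OF e f]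
    by (simp add: continuous_intros)
  from has_integral_mult_right[OF this, of "exp (\<i> * of_real pi * (e - 1/2))"]
  have "((\<lambda>x. exp (\<i> * of_real pi * (e - 1/2)) * (weight (1/2 + e) (1/2) x
     * (poly (cheb e k) (of_real x) * poly f (of_real x)))) has_integral 0) {-4..0}" by simp
  then show ?thesis
    by (rule has_integral_eq[rotated]) (simp add: of_real_powr_nonpos weight_def algebra_simps)
qed

theorem mainTheorem15:
  shows
    "(\<forall>(m::nat) (x::complex) a b w.
        a\<^sup>2 = x - 2 \<and> b\<^sup>2 = x + 2 \<and> w\<^sup>2 = x\<^sup>2 - 4 \<and> w = a * b \<longrightarrow>
          (x \<noteq> 2 \<longrightarrow>
             P m (x - 2) = 1 / 2 ^ (m + 1) * ((1 - b / a) * (x - w) ^ m + (1 + b / a) * (x + w) ^ m))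
          \<and> Q m (x - 2) = 1 / 2 ^ m * ((x - w) ^ m + (x + w) ^ m))
   \<and> (\<forall>(m::nat) (r::nat) (x::complex). r \<le> m div 2 \<longrightarrow>
          P m x = (\<Sum>j=0..r. (-1) ^ j * of_nat (r choose j) * (x + 2) ^ (r - j) * P (m - r - j) x)
          \<and> Q m x = (\<Sum>j=0..r. (-1) ^ j * of_nat (r choose j) * (x + 2) ^ (r - j) * Q (m - r - j) x))
   \<and> (\<forall>(k::nat) (f::complex poly). f = 0 \<or> degree f < k \<longrightarrow>
          ((\<lambda>x::real. of_real x powr (1/2) * of_real (4 + x) powr (-1/2)
              * P k (of_real x) * poly f (of_real x)) has_integral 0) {-4..0}
          \<and> ((\<lambda>x::real. of_real x powr (-1/2) * of_real (4 + x) powr (-1/2)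
              * Q k (of_real x) * poly f (of_real x)) has_integral 0) {-4..0})
   \<and> (\<forall>n::nat.
          (\<exists>p. is_factor_P n p) \<and> (\<exists>q. is_factor_Q n q)
          \<and> (\<forall>p. is_factor_P n p \<longrightarrow>
               ((\<forall>s. poly p s = poly p (1 - s)) \<or> (\<forall>s. poly p s = - poly p (1 - s)))
               \<and> (\<forall>s. poly p s = 0 \<longrightarrow> Re s = 1/2))
          \<and> (\<forall>q. is_factor_Q n q \<longrightarrow>
               ((\<forall>s. poly q s = poly q (1 - s)) \<or> (\<forall>s. poly q s = - poly q (1 - s)))
               \<and> (\<forall>s. poly q s = 0 \<longrightarrow> Re s = 1/2)))"
proof (intro conjI allI impI)
  fix m :: nat and x a b w :: complex
  assume "a\<^sup>2 = x - 2 \<and> b\<^sup>2 = x + 2 \<and> w\<^sup>2 = x\<^sup>2 - 4 \<and> w = a * b"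
  then have a: "a\<^sup>2 = x - 2" and b: "b\<^sup>2 = x + 2" and w: "w = a * b" by auto
  show "Q m (x - 2) = 1 / 2 ^ m * ((x - w) ^ m + (x + w) ^ m)"
    unfolding w by (rule cheb_radicals(2)[OF a b])
  assume "x \<noteq> 2"
  then show "P m (x - 2) = 1 / 2 ^ (m + 1) * ((1 - b / a) * (x - w) ^ m + (1 + b / a) * (x + w) ^ m)"
    unfolding w by (rule cheb_radicals(1)[OF a b])
next
  fix m r :: nat and x :: complex assume r: "r \<le> m div 2"
  show "P m x = (\<Sum>j=0..r. (-1) ^ j * of_nat (r choose j) * (x + 2) ^ (r - j) * P (m - r - j) x)"
    unfolding P_eq_cheb by (rule cheb_binomial_identity[OF r])
  show "Q m x = (\<Sum>j=0..r. (-1) ^ j * of_nat (r choose j) * (x + 2) ^ (r - j) * Q (m - r - j) x)"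
    unfolding Q_eq_cheb by (rule cheb_binomial_identity[OF r])
next
  fix k :: nat and f :: "complex poly" assume f: "f = 0 \<or> degree f < k"
  show "((\<lambda>x::real. of_real x powr (1/2) * of_real (4 + x) powr (-1/2)
          * P k (of_real x) * poly f (of_real x)) has_integral 0) {-4..0}"
    using cheb_orthogonal_has_integral[of 1 f k] f unfolding P_eq_cheb by simp
  show "((\<lambda>x::real. of_real x powr (-1/2) * of_real (4 + x) powr (-1/2)
          * Q k (of_real x) * poly f (of_real x)) has_integral 0) {-4..0}"
    using cheb_orthogonal_has_integral[of 0 f k] f unfolding Q_eq_cheb by simp
next
  fix n :: nat
  show "\<exists>p. is_factor_P n p" using is_factor_P_crit by blast
  show "\<exists>q. is_factor_Q n q" using is_factor_Q_crit by blast
next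
  fix n p assume "is_factor_P n p"
  then obtain k where "k \<noteq> 0" "p = smult k (crit_poly (crit_shift 1) n)"
    using is_factor_P_unique is_factor_P_crit by blast
  note * = smult_crit_properties[OF this]
  show "(\<forall>s. poly p s = poly p (1 - s)) \<or> (\<forall>s. poly p s = - poly p (1 - s))" using * ..
  fix s assume "poly p s = 0"
  then show "Re s = 1/2" using * by blast
next
  fix n q assume "is_factor_Q n q"
  then obtain k where "k \<noteq> 0" "q = smult k (crit_poly (crit_shift 0) n)"
    using is_factor_Q_unique is_factor_Q_crit by blast
  note * = smult_crit_properties[OF this]
  show "(\<forall>s. poly q s = poly q (1 - s)) \<or> (\<forall>s. poly q s = - poly q (1 - s))" using * ..
  fix s assume "poly q s = 0"
  then show "Re s = 1/2" using * by blast
qed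

end
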